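(* Let $(R^s_{\ell,\ell'})_{s\in\mathcal S,\ell,\ell'\ge1}$ be an array as in the context and let $R_{\ell,\ell'}=\sum_{s\in\mathcal S}\lambda_sR^s_{\ell,\ell'}$. Then there exist non-decreasing $(1/\lambda_s)$-Lipschitz functions $L_s:[0,1]\to[0,1]$, $s\in\mathcal S$, such that $R^s_{\ell,\ell'}=L_s(R_{\ell,\ell'})$ almost surely for all $s\in\mathcal S$ and all $\ell,\ell'\ge1$.
   Context: $\mathcal S$ is a finite set and $\lambda_s\in(0,1)$, $s\in\mathcal S$, with $\sum_s\lambda_s=1$. The array $(R^s_{\ell,\ell'})_{s\in\mathcal S,\ell,\ell'\ge1}$ is a limit in distribution (along a subsequence) of the arrays of within-species overlaps $(R_s(\sigma^\ell,\sigma^{\ell'}))_{s,\ell,\ell'}$, $R_s(\sigma^1,\sigma^2)=|I_s|^{-1}\sum_{i\in I_s}\sigma^1_i\sigma^2_i$, of i.i.d. replicas $(\sigma^\ell)$ drawn from random Gibbs measures $G_N$ on $\{-1,1\}^N$ (under $\mathbb EG_N^{\otimes\infty}$), where $\{1,\dots,N\}=\bigcup_sI_s$ with $|I_s|/N\to\lambda_s$; in particular, for each $s$ the array $(R^s_{\ell,\ell'})_{\ell,\ell'}$ is symmetric, nonnegative definite, weakly exchangeable, with entries in $[-1,1]$ and diagonal entries $1$. The array is assumed to satisfy the multi-species Ghirlanda-Guerra identities: for every bounded measurable $\varphi:[-1,1]^{|\mathcal S|}\to\mathbb R$, with $Q_{\ell,\ell'}=\varphi((R^s_{\ell,\ell'})_{s\in\mathcal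 S})$, every $n\ge2$ and every bounded measurable $f$ of $R^n=(R^s_{\ell,\ell'})_{s\in\mathcal S,\ell,\ell'\le n}$, $\mathbb Ef(R^n)Q_{1,n+1}=\frac1n\mathbb Ef(R^n)\mathbb EQ_{1,2}+\frac1n\sum_{\ell=2}^n\mathbb Ef(R^n)Q_{1,\ell}$. *)

theory Defs
  imports "HOL-Probability.Probability"
begin

text \<open>Spin configurations on \<open>{..<N}\<close> are encoded by the set \<open>A \<subseteq> {..<N}\<close> of
  sites with spin +1; all other sites carry spin -1.\<close>
definition spin :: "nat set \<Rightarrow> nat \<Rightarrow> real" where
  "spin A i = (if i \<in> A then 1 else -1)"

definition overlap :: "nat set \<Rightarrow> nat set \<Rightarrow> nat set \<Rightarrow> real" where
  "overlap J A B = (\<Sum>i\<in>J. spin A i * spin B i) / real (card J)"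

definition arr_idx :: "nat \<Rightarrow> ('s \<times> nat \<times> nat) set" where
  "arr_idx n = UNIV \<times> {..<n} \<times> {..<n}"

definition arr_space :: "nat \<Rightarrow> ('s \<times> nat \<times> nat \<Rightarrow> real) set" where
  "arr_space n = PiE (arr_idx n) (\<lambda>_. UNIV)"

definition arr_M :: "nat \<Rightarrow> ('s \<times> nat \<times> nat \<Rightarrow> real) measure" where
  "arr_M n = PiM (arr_idx n) (\<lambda>_. borel)"

definition corner :: "nat \<Rightarrow> ('s \<Rightarrow> nat \<Rightarrow> nat \<Rightarrow> real) \<Rightarrow> ('s \<times> nat \<times> nat \<Rightarrow> real)" where
  "corner n X = (\<lambda>(s, l, l') \<in> arr_idx n. X s l l')"

text \<open>Annealed expectation \<open>\<bbbE> G^{\<otimes> n} g(R^n)\<close> of a function g of the n x n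
  overlap array of n i.i.d. replicas from the random measure G on configurations of
  \<open>{..<N}\<close>, with species partition I.\<close>
definition annealed ::
  "'w measure \<Rightarrow> ('w \<Rightarrow> nat set \<Rightarrow> real) \<Rightarrow> nat \<Rightarrow> ('s \<Rightarrow> nat set) \<Rightarrow> nat
     \<Rightarrow> (('s \<times> nat \<times> nat \<Rightarrow> real) \<Rightarrow> real) \<Rightarrow> real" where
  "annealed P G N I n g =
     (\<integral>\<omega>. (\<Sum>\<sigma>\<in>PiE {..<n} (\<lambda>_. Pow {..<N}).
              (\<Prod>l<n. G \<omega> (\<sigma> l)) *
              g (\<lambda>(s, l, l') \<in> arr_idx n. overlap (I s) (\<sigma> l) (\<sigma> l'))) \<partial>P)"

text \<open>The array R (on probability space M) is a limit in distribution (i.e. of all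
  finite-dimensional distributions) of overlap arrays of random Gibbs measures
  \<open>G k\<close> on \<open>{-1,1}^{N k}\<close> (probability spaces \<open>P k\<close>), along a subsequence \<open>N k\<close>
  with species partitions \<open>I k s\<close> satisfying \<open>|I k s| / N k \<rightarrow> \<lambda> s\<close>.\<close>
definition overlap_limit ::
  "('s::finite \<Rightarrow> real) \<Rightarrow> 'm measure \<Rightarrow> ('m \<Rightarrow> 's \<Rightarrow> nat \<Rightarrow> nat \<Rightarrow> real)
     \<Rightarrow> (nat \<Rightarrow> nat) \<Rightarrow> (nat \<Rightarrow> 's \<Rightarrow> nat set) \<Rightarrow> (nat \<Rightarrow> 'w measure)
     \<Rightarrow> (nat \<Rightarrow> 'w \<Rightarrow> nat set \<Rightarrow> real) \<Rightarrow> bool" where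
  "overlap_limit lam M R N I P G \<longleftrightarrow>
    ( strict_mono N \<and>
      (\<forall>k. (\<Union>s. I k s) = {..<N k} \<and> (\<forall>s t. s \<noteq> t \<longrightarrow> I k s \<inter> I k t = {})) \<and>
      (\<forall>s. (\<lambda>k. real (card (I k s)) / real (N k)) \<longlonglongrightarrow> lam s) \<and>
      (\<forall>k. prob_space (P k)) \<and>
      (\<forall>k A. (\<lambda>\<omega>. G k \<omega> A) \<in> borel_measurable (P k)) \<and>
      (\<forall>k. \<forall>\<omega>\<in>space (P k). (\<forall>A. 0 \<le> G k \<omega> A) \<and> (\<forall>A. A \<notin> Pow {..<N k} \<longrightarrow> G k \<omega> A = 0)
            \<and> (\<Sum>A\<in>Pow {..<N k}. G k \<omega> A) = 1) \<and>
      (\<forall>n (g :: ('s \<times> nat \<times> nat \<Rightarrow> real) \<Rightarrow> real).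
          continuous_on (arr_space n) g \<and> bounded (g ` arr_space n) \<longrightarrow>
          (\<lambda>k. annealed (P k) (G k) (N k) (I k) n g)
            \<longlonglongrightarrow> (\<integral>\<omega>. g (corner n (R \<omega>)) \<partial>M)))"

text \<open>Multi-species Ghirlanda--Guerra identities (replicas indexed from 0, so
  \<open>Q_{1,n+1}\<close> becomes \<open>Q 0 n\<close>, \<open>Q_{1,2}\<close> becomes \<open>Q 0 1\<close>, and \<open>\<ell> = 2..n\<close> becomes
  \<open>l = 1..n-1\<close>).\<close>
definition multi_species_GG ::
  "'m measure \<Rightarrow> ('m \<Rightarrow> 's::finite \<Rightarrow> nat \<Rightarrow> nat \<Rightarrow> real) \<Rightarrow> bool" where
  "multi_species_GG M R \<longleftrightarrow>
    (\<forall>(\<phi> :: ('s \<Rightarrow> real) \<Rightarrow> real) (f :: ('s \<times> nat \<times> nat \<Rightarrow> real) \<Rightarrow> real) n.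
       \<phi> \<in> borel_measurable (PiM UNIV (\<lambda>_. borel)) \<and> (\<exists>B. \<forall>x. \<bar>\<phi> x\<bar> \<le> B) \<and>
       2 \<le> n \<and> f \<in> borel_measurable (arr_M n) \<and> (\<exists>B. \<forall>x. \<bar>f x\<bar> \<le> B) \<longrightarrow>
       (let Q = (\<lambda>\<omega> l l'. \<phi> (\<lambda>s. R \<omega> s l l')); F = (\<lambda>\<omega>. f (corner n (R \<omega>))) in
        (\<integral>\<omega>. F \<omega> * Q \<omega> 0 n \<partial>M) =
          (1 / real n) * (\<integral>\<omega>. F \<omega> \<partial>M) * (\<integral>\<omega>. Q \<omega> 0 1 \<partial>M)
          + (1 / real n) * (\<Sum>l\<in>{1..<n}. \<integral>\<omega>. F \<omega> * Q \<omega> 0 l \<partial>M)))"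

end

theory Submission
  imports Defs
begin

text \<open>
  Ultrametricity is obtained without representing the array by a random measure. Fix a
  constraint on the overlaps of n replicas that has positive probability and forces all overlaps of
  replica 0 to be \<open>< t\<close>. Given the constraint, the Ghirlanda--Guerra identities make the probability
  that replicas \<open>n, \<dots>, n+k-1\<close> all have overlap \<open>< t\<close> with replica 0 decay only like \<open>k\<close> to the power \<open>-\<gamma>\<close>,
  where \<open>\<gamma> = P(Q\<^sub>0\<^sub>1 \<ge> t) < 1\<close>. If no other replica could take the place of replica 0 while having overlap
  \<open>< t\<close> with it, this event would force replica 0 to be the only one among \<open>k + 1\<close> exchangeable
  candidates satisfying the constraint, which has probability at most \<open>1/(k + 1)\<close>. So replicas can be
  duplicated with small mutual overlaps, and positive semidefiniteness of the resulting large arrays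
  rules out negative overlaps and non-ultrametric triples.

  Applied to \<open>R\<^sup>s\<close>, \<open>R\<^sup>t\<close> and their average, ultrametricity makes the vectors \<open>(R\<^sup>s\<^sub>0\<^sub>1)\<^sub>s\<close> and
  \<open>(R\<^sup>s\<^sub>0\<^sub>2)\<^sub>s\<close> comparable almost surely. By the identities their joint law dominates half the product of
  the marginals, so the support of the overlap vector is a chain. On a chain each coordinate is a
  non-decreasing \<open>1/\<lambda>\<^sub>s\<close>-Lipschitz function of the weighted sum, which extends to \<open>[0,1]\<close>.
\<close>

subsection \<open>Ultrametricity of scalar Ghirlanda--Guerra arrays\<close>

abbreviation arrays :: "('i \<Rightarrow> real) measure" where
  "arrays \<equiv> PiM UNIV (\<lambda>_. borel)"

text \<open>\<open>\<tau> a\<close> is the type of replica \<open>a\<close>, and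
  \<open>V p q\<close> is the range allowed for overlaps between types \<open>p\<close> and
  \<open>q\<close>. Replicas of equal type are meant as copies of one another, with
  \<open>V p p\<close> restricting their mutual overlaps; self-overlaps are left free.\<close>

definition overlap_box :: "(nat \<Rightarrow> nat \<Rightarrow> real set) \<Rightarrow> (nat \<Rightarrow> nat) \<Rightarrow> nat \<Rightarrow> (nat \<times> nat \<Rightarrow> real) set" where
  "overlap_box V \<tau> n = {x. \<forall>a<n. \<forall>b<n. a \<noteq> b \<longrightarrow> x (a, b) \<in> V (\<tau> a) (\<tau> b)}"

lemma sets_overlap_box [measurable]:
  assumes [measurable]: "\<And>p q. V p q \<in> sets borel"
  shows "overlap_box V \<tau> n \<in> sets arrays"
proof -
  have "overlap_box V \<tau> n
      = {x \<in> space arrays. \<forall>a\<in>{..<n}. \<forall>b\<in>{..<n}. a \<noteq> b \<longrightarrow> x (a, b) \<in> V (\<tau> a) (\<tau> b)}"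
    by (auto simp: overlap_box_def space_PiM)
  also have "\<dots> \<in> sets arrays" by measurable
  finally show ?thesis .
qed

section \<open>Events of positive probability and permutations of replicas\<close>

lemma (in prob_space) expectation_indicator_Collect:
  "(\<integral>\<omega>. indicator {\<omega>. p \<omega>} \<omega> \<partial>M) = \<P>(\<omega> in M. p \<omega>)"
  "(\<integral>\<omega>. indicator {\<omega>. p \<omega>} \<omega> * indicator {\<omega>. q \<omega>} \<omega> \<partial>M) = \<P>(\<omega> in M. p \<omega> \<and> q \<omega>)"
proof -
  have int: "(\<integral>\<omega>. indicator {\<omega>. r \<omega>} \<omega> \<partial>M) = \<P>(\<omega> in M. r \<omega>)" for r
    by (simp add: Int_def conj_commute)
  show "(\<integral>\<omega>. indicator {\<omega>. p \<omega>} \<omega> \<partial>M) = \<P>(\<omega> in M. p \<omega>)"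
    by (rule int)
  show "(\<integral>\<omega>. indicator {\<omega>. p \<omega>} \<omega> * indicator {\<omega>. q \<omega>} \<omega> \<partial>M) = \<P>(\<omega> in M. p \<omega> \<and> q \<omega>)"
    using int[of "\<lambda>\<omega>. p \<omega> \<and> q \<omega>"] by (simp add: indicator_inter_arith[symmetric] Collect_conj_eq)
qed

lemma (in prob_space) prob_pos_witness:
  assumes [measurable]: "Measurable.pred M P"
    and "0 < \<P>(\<omega> in M. P \<omega>)" "AE \<omega> in M. R \<omega>"
  obtains \<omega> where "\<omega> \<in> space M" "P \<omega>" "R \<omega>"
proof (rule ccontr)
  assume *: "\<not> thesis"
  have "AE \<omega> in M. \<not> P \<omega>"
    using assms(3) AE_space by eventually_elim (use * that in blast)
  then have "\<P>(\<omega> in M. P \<omega>) = 0"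
    by (subst prob_Collect_eq_0) auto
  with assms(2) show False by simp
qed

text \<open>Countable subadditivity. It serves to replace a strict inequality by one with a fixed
  margin, and to localise overlaps in a cell of a grid.\<close>

lemma (in prob_space) ex_prob_pos:
  fixes P' :: "'i :: countable \<Rightarrow> 'a \<Rightarrow> bool"
  assumes [measurable]: "Measurable.pred M P" "\<And>i. Measurable.pred M (P' i)"
    and pos: "0 < \<P>(\<omega> in M. P \<omega>)" and imp: "AE \<omega> in M. P \<omega> \<longrightarrow> (\<exists>i. P' i \<omega>)"
  shows "\<exists>i. 0 < \<P>(\<omega> in M. P' i \<omega>)"
proof (rule ccontr)
  assume "\<not> ?thesis"
  then have "\<P>(\<omega> in M. P' i \<omega>) = 0" for i
    by (simp add: zero_less_measure_iff)
  then have "AE \<omega> in M. \<not> P' i \<omega>" for i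
    by (subst (asm) prob_Collect_eq_0) auto
  then have "AE \<omega> in M. \<forall>i. \<not> P' i \<omega>"
    by (simp add: AE_all_countable)
  then have "AE \<omega> in M. \<not> P \<omega>"
    using imp by eventually_elim blast
  then have "\<P>(\<omega> in M. P \<omega>) = 0"
    by (subst prob_Collect_eq_0) auto
  with pos show False by simp
qed

lemma ex_permutation_pair:
  fixes i j :: nat
  assumes "i \<noteq> j"
  shows "\<exists>\<pi> n. \<pi> permutes {..<n} \<and> \<pi> 0 = i \<and> \<pi> 1 = j"
proof -
  \<comment> \<open>\<open>k\<close> is where the swap of 0 and \<open>i\<close> sends
    \<open>j\<close>, so 1 has to be moved to \<open>k\<close> first; as \<open>k\<close> is not 0,
    that move fixes 0.\<close>
  define k where "k = Transposition.transpose 0 i j"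
  define \<pi> where "\<pi> = Transposition.transpose 0 i \<circ> Transposition.transpose 1 k"
  have "k \<noteq> 0" using assms by (auto simp: k_def Transposition.transpose_def split: if_splits)
  have "\<pi> permutes {..<i + j + 2}"
    unfolding \<pi>_def k_def
    by (intro permutes_compose permutes_swap_id) (auto simp: Transposition.transpose_def)
  moreover have "\<pi> 0 = i" "\<pi> 1 = j"
    using \<open>k \<noteq> 0\<close> by (auto simp: \<pi>_def k_def)
  ultimately show ?thesis by blast
qed

text \<open>These are the properties shared by every species and by every convex combination of
  species. The identities are stated for indicators and multiplied by \<open>n\<close>; the event
  \<open>S\<close> lives on the full array but depends only on the first \<open>n\<close>
  replicas.\<close>

locale gg_array = prob_space M for M :: "'a measure" +
  fixes Q :: "'a \<Rightarrow> nat \<times> nat \<Rightarrow> real"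
  assumes Q_measurable [measurable]: "\<And>i. (\<lambda>\<omega>. Q \<omega> i) \<in> borel_measurable M"
    and symmetric: "\<And>i j. AE \<omega> in M. Q \<omega> (i, j) = Q \<omega> (j, i)"
    and diagonal: "\<And>i. AE \<omega> in M. Q \<omega> (i, i) = 1"
    and positive_semidefinite:
      "\<And>c n. AE \<omega> in M. 0 \<le> (\<Sum>i<n. \<Sum>j<n. c i * c j * Q \<omega> (i, j))"
    and exchangeable: "\<And>\<pi> n X. \<pi> permutes {..<n} \<Longrightarrow> X \<in> sets arrays \<Longrightarrow>
      \<P>(\<omega> in M. (\<lambda>(i, j). Q \<omega> (\<pi> i, \<pi> j)) \<in> X) = \<P>(\<omega> in M. Q \<omega> \<in> X)"
    and ghirlanda_guerra: "\<And>n S A. 2 \<le> n \<Longrightarrow> S \<in> sets arrays \<Longrightarrow>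
      (\<And>x y. (\<And>i j. i < n \<Longrightarrow> j < n \<Longrightarrow> x (i, j) = y (i, j)) \<Longrightarrow> x \<in> S \<longleftrightarrow> y \<in> S) \<Longrightarrow>
      A \<in> sets borel \<Longrightarrow>
      real n * \<P>(\<omega> in M. Q \<omega> \<in> S \<and> Q \<omega> (0, n) \<in> A) =
        \<P>(\<omega> in M. Q \<omega> \<in> S) * \<P>(\<omega> in M. Q \<omega> (0, 1) \<in> A)
        + (\<Sum>l\<in>{1..<n}. \<P>(\<omega> in M. Q \<omega> \<in> S \<and> Q \<omega> (0, l) \<in> A))"
begin

lemma measurable_Q [measurable]: "Q \<in> measurable M arrays"
  by (rule measurable_PiM_single') (auto simp: space_PiM)

section \<open>Duplicating a replica\<close>

text \<open>The candidates for the role of replica 0 are 0 and \<open>n\<close>, ...,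
  \<open>n + k - 1\<close>. The events that a given candidate is the only fitting one are disjoint
  and, by exchangeability, equally likely. On the event in \<open>E k\<close> no candidate other
  than 0 fits almost surely, since it would be a copy of replica 0 and place the array in the null
  box on \<open>n + 1\<close> replicas.\<close>

lemma replica_unique_prob_bound:
  fixes V \<tau> n and t :: real
  defines "E \<equiv> \<lambda>k. \<P>(\<omega> in M. Q \<omega> \<in> overlap_box V \<tau> n \<and> (\<forall>j<k. Q \<omega> (0, n + j) < t))"
  assumes V [measurable]: "\<And>p q. V p q \<in> sets borel"
    and diag: "V (\<tau> 0) (\<tau> 0) = {..<t}"
    and n: "0 < n" "\<tau> n = \<tau> 0"
    and null: "\<P>(\<omega> in M. Q \<omega> \<in> overlap_box V \<tau> (Suc n)) = 0"
  shows "real (Suc k) * E k \<le> 1"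
proof -
  \<comment> \<open>\<open>e j\<close> substitutes candidate \<open>j\<close> for replica 0 and
    keeps the replicas 1, ..., \<open>n - 1\<close>.\<close>
  define e where "e j a = (if a = 0 then j else a)" for j a :: nat
  define fit where "fit j x \<longleftrightarrow> (\<forall>a\<in>{..<n}. \<forall>b\<in>{..<n}. a \<noteq> b \<longrightarrow> x (e j a, e j b) \<in> V (\<tau> a) (\<tau> b))"
    for j and x :: "nat \<times> nat \<Rightarrow> real"
  define J where "J = insert 0 {n..<n + k}"
  define only where "only j x \<longleftrightarrow> fit j x \<and> (\<forall>i\<in>J - {j}. \<not> fit i x)" for j x
  have [measurable]: "Measurable.pred arrays (fit j)" for j
    unfolding fit_def by measurable
  have "finite J" "0 \<in> J" by (simp_all add: J_def)
  have only_meas [measurable]: "Measurable.pred arrays (only j)" for j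
    unfolding only_def using \<open>finite J\<close> by measurable
  have fit0: "fit 0 x \<longleftrightarrow> x \<in> overlap_box V \<tau> n" for x
    by (auto simp: fit_def overlap_box_def e_def)
  have eq: "\<P>(\<omega> in M. only j (Q \<omega>)) = \<P>(\<omega> in M. only 0 (Q \<omega>))" if j: "j \<in> J" for j
  proof -
    define \<pi> where "\<pi> = Transposition.transpose 0 j"
    have \<pi>: "\<pi> permutes {..<n + k}"
      unfolding \<pi>_def using j n by (intro permutes_swap_id) (auto simp: J_def)
    \<comment> \<open>The swap of 0 and \<open>j\<close> fixes 1, ..., \<open>n - 1\<close>, so it
      acts on substituted tuples only through the candidate.\<close>
    have e: "\<pi> (e i a) = e (\<pi> i) a" if "i \<in> J" "a < n" for i a
      using that j by (auto simp: e_def \<pi>_def J_def Transposition.transpose_def)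
    have fit_\<pi>: "fit i (\<lambda>(a, b). x (\<pi> a, \<pi> b)) \<longleftrightarrow> fit (\<pi> i) x" if "i \<in> J" for i x
      using e[OF that] by (auto simp: fit_def)
    have "\<pi> 0 = j" by (simp add: \<pi>_def)
    have image: "\<pi> ` (J - {0}) = J - {j}"
      using j \<open>0 \<in> J\<close> by (auto simp: \<pi>_def Transposition.transpose_def image_iff)
    have "only 0 (\<lambda>(a, b). x (\<pi> a, \<pi> b)) \<longleftrightarrow> only j x" for x
    proof -
      have "only 0 (\<lambda>(a, b). x (\<pi> a, \<pi> b)) \<longleftrightarrow> fit (\<pi> 0) x \<and> (\<forall>i\<in>J - {0}. \<not> fit (\<pi> i) x)"
        using fit_\<pi> \<open>0 \<in> J\<close> by (auto simp: only_def)
      also have "\<dots> \<longleftrightarrow> fit j x \<and> (\<forall>i\<in>\<pi> ` (J - {0}). \<not> fit i x)"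
        by (simp add: \<open>\<pi> 0 = j\<close>)
      finally show ?thesis by (simp only: image only_def)
    qed
    moreover have "{x \<in> space arrays. only 0 x} \<in> sets arrays" by measurable
    ultimately show ?thesis
      using exchangeable[OF \<pi>, of "{x. only 0 x}"] by (simp add: space_PiM)
  qed
  have "real (Suc k) * \<P>(\<omega> in M. only 0 (Q \<omega>)) = (\<Sum>j\<in>J. \<P>(\<omega> in M. only j (Q \<omega>)))"
    using n by (simp add: eq) (simp add: J_def)
  also have "\<dots> = prob (\<Union>j\<in>J. {\<omega> \<in> space M. only j (Q \<omega>)})"
  proof (rule finite_measure_finite_Union[symmetric, OF \<open>finite J\<close>])
    show "disjoint_family_on (\<lambda>j. {\<omega> \<in> space M. only j (Q \<omega>)}) J"
      by (auto simp: disjoint_family_on_def only_def)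
  qed auto
  also have "\<dots> \<le> 1" by simp
  finally have bound: "real (Suc k) * \<P>(\<omega> in M. only 0 (Q \<omega>)) \<le> 1" .
  have not_both: "AE \<omega> in M. Q \<omega> \<in> overlap_box V \<tau> n \<and> Q \<omega> (0, n + j) < t \<longrightarrow> \<not> fit (n + j) (Q \<omega>)"
    if j: "j < k" for j
  proof -
    \<comment> \<open>Moving replica \<open>n + j\<close> to position \<open>n\<close> makes a
      second fitting candidate the copy that the larger box asks for.\<close>
    define \<pi> where "\<pi> = Transposition.transpose n (n + j)"
    have \<pi>: "\<pi> permutes {..<n + k}"
      unfolding \<pi>_def using j n by (intro permutes_swap_id) auto
    have "\<P>(\<omega> in M. (\<lambda>(a, b). Q \<omega> (\<pi> a, \<pi> b)) \<in> overlap_box V \<tau> (Suc n)) = 0"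
      using exchangeable[OF \<pi>, of "overlap_box V \<tau> (Suc n)"] null by simp
    moreover have "(\<lambda>\<omega>. \<lambda>(a, b). Q \<omega> (\<pi> a, \<pi> b)) \<in> measurable M arrays"
      by (rule measurable_PiM_single') (auto simp: space_PiM split_beta)
    ultimately have "AE \<omega> in M. (\<lambda>(a, b). Q \<omega> (\<pi> a, \<pi> b)) \<notin> overlap_box V \<tau> (Suc n)"
      by (subst (asm) prob_Collect_eq_0) (auto intro: measurable_sets)
    with symmetric[of 0 "n + j"] show ?thesis
    proof eventually_elim
      case (elim \<omega>)
      have "(\<lambda>(a, b). Q \<omega> (\<pi> a, \<pi> b)) \<in> overlap_box V \<tau> (Suc n)"
        if *: "Q \<omega> \<in> overlap_box V \<tau> n" "Q \<omega> (0, n + j) < t" "fit (n + j) (Q \<omega>)"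
        unfolding overlap_box_def mem_Collect_eq
      proof (intro allI impI, unfold prod.case)
        fix a b assume ab: "a < Suc n" "b < Suc n" "a \<noteq> b"
        have id: "\<pi> c = c" if "c < n" for c using that by (simp add: \<pi>_def)
        have \<pi>n: "\<pi> n = n + j" by (simp add: \<pi>_def)
        have fit: "Q \<omega> (e (n + j) c, e (n + j) d) \<in> V (\<tau> c) (\<tau> d)"
          if "c < n" "d < n" "c \<noteq> d" for c d
          using *(3) that unfolding fit_def by auto
        consider "a < n" "b < n" | "a = 0" "b = n" | "a = n" "b = 0"
          | "0 < a" "a < n" "b = n" | "0 < b" "b < n" "a = n"
          using ab by (metis less_Suc_eq not_gr_zero)
        then show "Q \<omega> (\<pi> a, \<pi> b) \<in> V (\<tau> a) (\<tau> b)"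
        proof cases
          case 1
          then have "Q \<omega> (a, b) \<in> V (\<tau> a) (\<tau> b)"
            using *(1) ab unfolding overlap_box_def by blast
          then show ?thesis using 1 by (simp add: id)
        next
          case 2 then show ?thesis using *(2) n diag by (simp add: id \<pi>n)
        next
          case 3 then show ?thesis using *(2) n diag elim(1) by (simp add: id \<pi>n)
        next
          case 4
          then have "Q \<omega> (e (n + j) a, e (n + j) 0) \<in> V (\<tau> a) (\<tau> 0)"
            using fit[of a 0] n(1) by simp
          then show ?thesis using 4 n(2) by (simp add: id \<pi>n e_def)
        next
          case 5
          then have "Q \<omega> (e (n + j) 0, e (n + j) b) \<in> V (\<tau> 0) (\<tau> b)"
            using fit[of 0 b] n(1) by simp
          then show ?thesis using 5 n(2) by (simp add: id \<pi>n e_def)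
        qed
      qed
      then show ?case using elim by blast
    qed
  qed
  have "E k \<le> \<P>(\<omega> in M. only 0 (Q \<omega>))"
    unfolding E_def
  proof (rule finite_measure_mono_AE)
    have "AE \<omega> in M. \<forall>j\<in>{..<k}.
        Q \<omega> \<in> overlap_box V \<tau> n \<and> Q \<omega> (0, n + j) < t \<longrightarrow> \<not> fit (n + j) (Q \<omega>)"
      by (rule AE_finite_allI) (auto intro: not_both)
    then show "AE \<omega> in M. \<omega> \<in> {\<omega> \<in> space M. Q \<omega> \<in> overlap_box V \<tau> n \<and> (\<forall>j<k. Q \<omega> (0, n + j) < t)}
        \<longrightarrow> \<omega> \<in> {\<omega> \<in> space M. only 0 (Q \<omega>)}"
    proof eventually_elim
      case (elim \<omega>)
      have "\<not> fit i (Q \<omega>)"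
        if "Q \<omega> \<in> overlap_box V \<tau> n" "\<forall>j<k. Q \<omega> (0, n + j) < t" "i \<in> {n..<n + k}" for i
        using elim that by (auto dest!: bspec[of _ _ "i - n"] spec[of _ "i - n"])
      then show ?case
        by (auto simp: only_def fit0 J_def)
    qed
  qed measurable
  then have "real (Suc k) * E k \<le> real (Suc k) * \<P>(\<omega> in M. only 0 (Q \<omega>))"
    by (intro mult_left_mono) auto
  then show ?thesis using bound by (rule order_trans)
qed

text \<open>On the conditioning event replica 0 already has overlap below \<open>t\<close> with the
  replicas 1, ..., \<open>n + k - 1\<close>. In the identity for \<open>n + k\<close> replicas each
  of the \<open>n + k - 1\<close> summands is therefore the full probability
  \<open>E k\<close>.\<close>

lemma box_below_prob_step:
  fixes V \<tau> n and t :: real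
  defines "E \<equiv> \<lambda>k. \<P>(\<omega> in M. Q \<omega> \<in> overlap_box V \<tau> n \<and> (\<forall>j<k. Q \<omega> (0, n + j) < t))"
  assumes V [measurable]: "\<And>p q. V p q \<in> sets borel"
    and below: "\<And>q. V (\<tau> 0) q \<subseteq> {..<t}"
    and n: "2 \<le> n"
  shows "real (n + k) * E (Suc k) = (real (n + k) - 1 + \<P>(\<omega> in M. Q \<omega> (0, 1) < t)) * E k"
proof -
  define S where "S = overlap_box V \<tau> n \<inter> {x. \<forall>j\<in>{..<k}. x (0, n + j) < t}"
  have "{x \<in> space arrays. \<forall>j\<in>{..<k}. x (0, n + j) < t} \<in> sets arrays" by measurable
  then have [measurable]: "S \<in> sets arrays" unfolding S_def by (simp add: space_PiM)
  have E: "E k = \<P>(\<omega> in M. Q \<omega> \<in> S)"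
    unfolding E_def S_def by (rule arg_cong[where f = prob]) auto
  have less: "Q \<omega> (0, l) < t" if "Q \<omega> \<in> S" "l \<in> {1..<n + k}" for l \<omega>
  proof (cases "l < n")
    case True
    then have "Q \<omega> (0, l) \<in> V (\<tau> 0) (\<tau> l)" using that by (auto simp: S_def overlap_box_def)
    then show ?thesis using below by auto
  next
    case False
    then have "l - n \<in> {..<k}" using that by auto
    then have "Q \<omega> (0, n + (l - n)) < t" using that(1) unfolding S_def by blast
    then show ?thesis using False by simp
  qed
  have "real (n + k) * \<P>(\<omega> in M. Q \<omega> \<in> S \<and> Q \<omega> (0, n + k) \<in> {..<t}) =
        \<P>(\<omega> in M. Q \<omega> \<in> S) * \<P>(\<omega> in M. Q \<omega> (0, 1) \<in> {..<t})
        + (\<Sum>l\<in>{1..<n + k}. \<P>(\<omega> in M. Q \<omega> \<in> S \<and> Q \<omega> (0, l) \<in> {..<t}))"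
  proof (rule ghirlanda_guerra)
    fix x y :: "nat \<times> nat \<Rightarrow> real"
    assume "\<And>i j. i < n + k \<Longrightarrow> j < n + k \<Longrightarrow> x (i, j) = y (i, j)"
    then show "x \<in> S \<longleftrightarrow> y \<in> S" using n by (auto simp: S_def overlap_box_def)
  qed (use n in auto)
  also have "(\<Sum>l\<in>{1..<n + k}. \<P>(\<omega> in M. Q \<omega> \<in> S \<and> Q \<omega> (0, l) \<in> {..<t}))
      = (\<Sum>l\<in>{1..<n + k}. \<P>(\<omega> in M. Q \<omega> \<in> S))"
    by (intro sum.cong refl arg_cong[where f = prob]) (auto dest: less)
  also have "\<P>(\<omega> in M. Q \<omega> \<in> S \<and> Q \<omega> (0, n + k) \<in> {..<t}) = E (Suc k)"
    unfolding E_def S_def by (rule arg_cong[where f = prob]) (auto simp: less_Suc_eq)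
  finally show ?thesis
    using n by (simp add: E algebra_simps of_nat_diff)
qed

text \<open>If the larger box were null, recursion and symmetry bound would conflict. The quantity
  \<open>u k = (n + k - 1) * E k\<close> satisfies \<open>u (k + 1) = u k + \<beta> * E k\<close>,
  so it grows at least like a harmonic series, while \<open>E k \<le> 1 / (k + 1)\<close> keeps it
  bounded.\<close>

lemma box_duplicate_first:
  assumes V [measurable]: "\<And>p q. V p q \<in> sets borel"
    and below: "\<And>q. V (\<tau> 0) q \<subseteq> {..<t}"
    and diag: "V (\<tau> 0) (\<tau> 0) = {..<t}"
    and n: "2 \<le> n" "\<tau> n = \<tau> 0"
    and pos: "0 < \<P>(\<omega> in M. Q \<omega> \<in> overlap_box V \<tau> n)"
  shows "0 < \<P>(\<omega> in M. Q \<omega> \<in> overlap_box V \<tau> (Suc n))"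
proof (rule ccontr)
  assume "\<not> ?thesis"
  then have null: "\<P>(\<omega> in M. Q \<omega> \<in> overlap_box V \<tau> (Suc n)) = 0"
    by (simp add: zero_less_measure_iff)
  define E where "E k = \<P>(\<omega> in M. Q \<omega> \<in> overlap_box V \<tau> n \<and> (\<forall>j<k. Q \<omega> (0, n + j) < t))" for k
  define \<beta> where "\<beta> = \<P>(\<omega> in M. Q \<omega> (0, 1) < t)"
  define u where "u k = real (n + k - 1) * E k" for k
  have E0: "E 0 = \<P>(\<omega> in M. Q \<omega> \<in> overlap_box V \<tau> n)" by (simp add: E_def)
  have "0 < \<beta>"
  proof -
    have "Q \<omega> (0, 1) < t" if "Q \<omega> \<in> overlap_box V \<tau> n" for \<omega>
    proof -
      have "Q \<omega> (0, 1) \<in> V (\<tau> 0) (\<tau> 1)" using that n by (auto simp: overlap_box_def)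
      then show ?thesis using below by auto
    qed
    then have "E 0 \<le> \<beta>"
      unfolding E0 \<beta>_def by (intro finite_measure_mono) auto
    with pos E0 show ?thesis by simp
  qed
  have bound: "real (Suc k) * E k \<le> 1" for k
    unfolding E_def using n by (intro replica_unique_prob_bound[OF V diag _ _ null]) auto
  have step: "u (Suc k) = u k + \<beta> * E k" for k
    using box_below_prob_step[of V \<tau> t n k, OF V below n(1)] n
    by (simp add: u_def E_def \<beta>_def of_nat_diff algebra_simps)
  have u0: "0 < u 0" using pos n by (simp add: u_def E0)
  have u_mono: "u 0 \<le> u k" for k
  proof (induction k)
    case (Suc k)
    have "0 \<le> \<beta> * E k" using \<open>0 < \<beta>\<close> by (simp add: E_def)
    then show ?case using Suc step[of k] by simp
  qed simp
  have u_lower: "u 0 + \<beta> * u 0 * (\<Sum>j<k. 1 / real (n + j - 1)) \<le> u k" for k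
  proof (induction k)
    case (Suc k)
    have "u 0 / real (n + k - 1) \<le> E k"
      using u_mono[of k] n by (simp add: u_def field_simps)
    then have "\<beta> * (u 0 / real (n + k - 1)) \<le> \<beta> * E k"
      using \<open>0 < \<beta>\<close> by (intro mult_left_mono) auto
    then show ?case using Suc step[of k] by (simp add: algebra_simps)
  qed simp
  have u_upper: "u k \<le> real n - 1" for k
  proof -
    \<comment> \<open>The two sides differ by \<open>k * (n - 2)\<close>.\<close>
    have "real (n + k - 1) \<le> real (Suc k) * (real n - 1)"
    proof -
      have "0 \<le> real k * (real n - 2)" using n by simp
      then show ?thesis using n by (simp add: algebra_simps of_nat_diff)
    qed
    then have "u k \<le> real (Suc k) * (real n - 1) * E k"
      unfolding u_def by (intro mult_right_mono) (auto simp: E_def)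
    also have "\<dots> = (real n - 1) * (real (Suc k) * E k)" by simp
    also have "\<dots> \<le> (real n - 1) * 1"
      using bound[of k] n by (intro mult_left_mono) auto
    finally show ?thesis by simp
  qed
  have "summable (\<lambda>j. 1 / real (n + j - 1))"
  proof (rule summableI_nonneg_bounded)
    fix k
    have "u 0 * (1 + \<beta> * (\<Sum>j<k. 1 / real (n + j - 1))) \<le> real n - 1"
      using u_lower[of k] u_upper[of k] by (simp add: algebra_simps)
    then have "\<beta> * (\<Sum>j<k. 1 / real (n + j - 1)) \<le> (real n - 1) / u 0 - 1"
      using u0 by (simp add: field_simps)
    then show "(\<Sum>j<k. 1 / real (n + j - 1)) \<le> ((real n - 1) / u 0 - 1) / \<beta>"
      using \<open>0 < \<beta>\<close> by (simp add: field_simps)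
  qed auto
  then have "summable (\<lambda>j. 1 / real (j + (n - 1)))"
    using n by (simp add: add.commute)
  then have "summable (\<lambda>j. inverse (real j))"
    using summable_iff_shift[of "\<lambda>j. 1 / real j" "n - 1"] by (simp add: field_simps)
  then show False using not_summable_harmonic[where 'a = real] by simp
qed

text \<open>Swapping replicas 0 and \<open>i\<close> reduces this to duplicating the first replica;
  replica \<open>n\<close> stays in place because \<open>i < n\<close>. The threshold may depend on
  the type being duplicated.\<close>

lemma box_duplicate:
  assumes V [measurable]: "\<And>p q. V p q \<in> sets borel"
    and below: "\<And>p q. V p q \<subseteq> {..<t p}"
    and diag: "\<And>p. V p p = {..<t p}"
    and n: "2 \<le> n" "i < n" "\<tau> n = \<tau> i"
    and pos: "0 < \<P>(\<omega> in M. Q \<omega> \<in> overlap_box V \<tau> n)"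
  shows "0 < \<P>(\<omega> in M. Q \<omega> \<in> overlap_box V \<tau> (Suc n))"
proof -
  define \<pi> where "\<pi> = Transposition.transpose 0 i"
  have \<pi>: "\<pi> permutes {..<m}" if "n \<le> m" for m
    unfolding \<pi>_def using n that by (intro permutes_swap_id) auto
  have "\<pi> (\<pi> a) = a" for a by (simp add: \<pi>_def)
  have iff: "(\<lambda>(a, b). x (\<pi> a, \<pi> b)) \<in> overlap_box V \<tau> m \<longleftrightarrow> x \<in> overlap_box V (\<tau> \<circ> \<pi>) m"
    if "n \<le> m" for m and x :: "nat \<times> nat \<Rightarrow> real"
  proof -
    have less: "\<pi> a < m \<longleftrightarrow> a < m" for a
      using permutes_in_image[OF \<pi>[OF that]] by auto
    have ne: "\<pi> a = \<pi> b \<longleftrightarrow> a = b" for a b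
      by (metis \<open>\<And>a. \<pi> (\<pi> a) = a\<close>)
    show ?thesis
      unfolding overlap_box_def
      by (auto simp: less ne) (metis less ne \<open>\<And>a. \<pi> (\<pi> a) = a\<close>)+
  qed
  have eq: "\<P>(\<omega> in M. Q \<omega> \<in> overlap_box V (\<tau> \<circ> \<pi>) m) = \<P>(\<omega> in M. Q \<omega> \<in> overlap_box V \<tau> m)"
    if "n \<le> m" for m
    using exchangeable[OF \<pi>[OF that], of "overlap_box V \<tau> m"] by (simp add: iff[OF that])
  have "(\<tau> \<circ> \<pi>) n = (\<tau> \<circ> \<pi>) 0"
    using n by (simp add: \<pi>_def)
  then have "0 < \<P>(\<omega> in M. Q \<omega> \<in> overlap_box V (\<tau> \<circ> \<pi>) (Suc n))"
    using n pos below diag by (intro box_duplicate_first[where t = "t ((\<tau> \<circ> \<pi>) 0)"]) (auto simp: eq)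
  then show ?thesis by (simp add: eq)
qed

text \<open>With types of period \<open>d\<close>, replica \<open>m\<close> is a copy of replica
  \<open>m - d\<close>. Repeated duplication thus yields arbitrarily many copies of each of the
  \<open>d\<close> types.\<close>

lemma box_periodic:
  assumes V: "\<And>p q. V p q \<in> sets borel" "\<And>p q. V p q \<subseteq> {..<t p}" "\<And>p. V p p = {..<t p}"
    and n: "2 \<le> n" "0 < d" "d \<le> n" "n \<le> m"
    and pos: "0 < \<P>(\<omega> in M. Q \<omega> \<in> overlap_box V (\<lambda>i. i mod d) n)"
  shows "0 < \<P>(\<omega> in M. Q \<omega> \<in> overlap_box V (\<lambda>i. i mod d) m)"
  using n(4)
proof (induction m rule: dec_induct)
  case (step m)
  have "m mod d = (m - d) mod d"
    using step n by (simp add: le_mod_geq)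
  then show ?case
    using step n by (intro box_duplicate[OF V, of m "m - d"]) auto
qed (fact pos)

section \<open>Bounds, nonnegativity and ultrametricity\<close>

lemma AE_exchange:
  assumes "\<pi> permutes {..<n}" and [measurable]: "Measurable.pred arrays P"
    and "AE \<omega> in M. P (Q \<omega>)"
  shows "AE \<omega> in M. P (\<lambda>(i, j). Q \<omega> (\<pi> i, \<pi> j))"
proof -
  have [measurable]: "(\<lambda>\<omega>. \<lambda>(i, j). Q \<omega> (\<pi> i, \<pi> j)) \<in> measurable M arrays"
    by (rule measurable_PiM_single') (auto simp: space_PiM split_beta)
  have "{x \<in> space arrays. P x} \<in> sets arrays" by measurable
  then have "\<P>(\<omega> in M. P (\<lambda>(i, j). Q \<omega> (\<pi> i, \<pi> j))) = \<P>(\<omega> in M. P (Q \<omega>))"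
    using exchangeable[OF assms(1), of "{x. P x}"] by (simp add: space_PiM)
  also have "\<dots> = 1"
    using assms(3) by (subst prob_Collect_eq_1) auto
  finally show ?thesis
    by (subst (asm) prob_Collect_eq_1) auto
qed

lemma AE_pair:
  assumes "i \<noteq> j" and [measurable]: "Measurable.pred borel P"
    and "AE \<omega> in M. P (Q \<omega> (0, 1))"
  shows "AE \<omega> in M. P (Q \<omega> (i, j))"
proof -
  obtain \<pi> n where "\<pi> permutes {..<n}" "\<pi> 0 = i" "\<pi> 1 = j"
    using ex_permutation_pair[OF assms(1)] by blast
  then show ?thesis
    using AE_exchange[of \<pi> n "\<lambda>x. P (x (0, 1))"] assms(3) by simp
qed

lemma Q_bounds:
  assumes "i \<noteq> j"
  shows "AE \<omega> in M. -1 \<le> Q \<omega> (i, j) \<and> Q \<omega> (i, j) \<le> 1"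
proof (rule AE_pair[OF assms])
  show "AE \<omega> in M. -1 \<le> Q \<omega> (0, 1) \<and> Q \<omega> (0, 1) \<le> 1"
    \<comment> \<open>The test vectors (1, 1) and (1, -1) give the lower and the upper
      bound.\<close>
    using symmetric[of 0 1] diagonal[of 0] diagonal[of 1]
      positive_semidefinite[where n = 2 and c = "\<lambda>_. 1"]
      positive_semidefinite[where n = 2 and c = "\<lambda>i. (-1) ^ i"]
    by eventually_elim (auto simp: numeral_2_eq_2)
qed measurable

text \<open>An overlap below \<open>- \<epsilon>\<close> with positive probability could be
  duplicated into \<open>m\<close> replicas with all mutual overlaps below
  \<open>- \<epsilon>\<close>. For large \<open>m\<close> the quadratic form with coefficients 1
  would then be negative.\<close>

lemma Q_nonneg:
  assumes "i \<noteq> j"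
  shows "AE \<omega> in M. 0 \<le> Q \<omega> (i, j)"
proof (rule AE_pair[OF assms])
  show "AE \<omega> in M. 0 \<le> Q \<omega> (0, 1)"
  proof (rule ccontr)
    assume "\<not> ?thesis"
    then have "\<P>(\<omega> in M. Q \<omega> (0, 1) < 0) \<noteq> 0"
      by (subst prob_Collect_eq_0) (auto simp: not_less)
    then have "0 < \<P>(\<omega> in M. Q \<omega> (0, 1) < 0)"
      by (simp add: zero_less_measure_iff)
    moreover have "\<exists>k. Q \<omega> (0, 1) < - (1 / real (Suc k))" if "Q \<omega> (0, 1) < 0" for \<omega>
    proof -
      obtain k where "inverse (real (Suc k)) < - Q \<omega> (0, 1)"
        using reals_Archimedean[of "- Q \<omega> (0, 1)"] \<open>Q \<omega> (0, 1) < 0\<close> by auto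
      then show ?thesis by (intro exI[of _ k]) (simp add: inverse_eq_divide)
    qed
    ultimately have "\<exists>k. 0 < \<P>(\<omega> in M. Q \<omega> (0, 1) < - (1 / real (Suc k)))"
      by (intro ex_prob_pos[of "\<lambda>\<omega>. Q \<omega> (0, 1) < 0"]) auto
    then obtain k where k: "0 < \<P>(\<omega> in M. Q \<omega> (0, 1) < - (1 / real (Suc k)))"
      by blast
    define \<epsilon> where "\<epsilon> = 1 / real (Suc k)"
    define V where "V = (\<lambda>(_ :: nat) (_ :: nat). {..< - \<epsilon>})"
    have V [measurable]: "V p q \<in> sets borel" for p q by (simp add: V_def)
    have "AE \<omega> in M. Q \<omega> (0, 1) < - \<epsilon> \<longrightarrow> Q \<omega> \<in> overlap_box V (\<lambda>i. i mod 1) 2"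
      using symmetric[of 0 1]
      by eventually_elim (auto simp: overlap_box_def V_def less_2_cases_iff)
    then have "\<P>(\<omega> in M. Q \<omega> (0, 1) < - \<epsilon>) \<le> \<P>(\<omega> in M. Q \<omega> \<in> overlap_box V (\<lambda>i. i mod 1) 2)"
      by (intro finite_measure_mono_AE) (auto simp: V_def)
    with k have pos: "0 < \<P>(\<omega> in M. Q \<omega> \<in> overlap_box V (\<lambda>i. i mod 1) 2)"
      by (simp add: \<epsilon>_def)
    \<comment> \<open>As \<open>\<epsilon> = 1 / (k + 1)\<close>, the \<open>m - 1 = k + 2\<close>
      off-diagonal entries of a row outweigh its diagonal entry 1.\<close>
    define m where "m = k + 3"
    have "0 < \<P>(\<omega> in M. Q \<omega> \<in> overlap_box V (\<lambda>i. i mod 1) m)"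
      by (rule box_periodic[where t = "\<lambda>_. - \<epsilon>", OF V _ _ _ _ _ _ pos]) (simp_all add: V_def m_def)
    moreover have "AE \<omega> in M. (\<forall>i\<in>{..<m}. Q \<omega> (i, i) = 1)
        \<and> 0 \<le> (\<Sum>i<m. \<Sum>j<m. 1 * 1 * Q \<omega> (i, j))"
      by (intro AE_conjI AE_finite_allI diagonal positive_semidefinite[where c = "\<lambda>_. 1"]) simp
    ultimately obtain \<omega> where box: "Q \<omega> \<in> overlap_box V (\<lambda>i. i mod 1) m"
      and R: "(\<forall>i\<in>{..<m}. Q \<omega> (i, i) = 1) \<and> 0 \<le> (\<Sum>i<m. \<Sum>j<m. 1 * 1 * Q \<omega> (i, j))"
      by (rule prob_pos_witness[rotated]) (use that in blast, measurable)
    have "(\<Sum>j<m. Q \<omega> (i, j)) \<le> 1 - real (m - 1) * \<epsilon>" if "i < m" for i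
    proof -
      have "(\<Sum>j<m. Q \<omega> (i, j)) = 1 + (\<Sum>j\<in>{..<m} - {i}. Q \<omega> (i, j))"
        using that R by (subst sum.remove[of _ i]) auto
      also have "(\<Sum>j\<in>{..<m} - {i}. Q \<omega> (i, j)) \<le> (\<Sum>j\<in>{..<m} - {i}. - \<epsilon>)"
        using that box by (intro sum_mono less_imp_le) (auto simp: overlap_box_def V_def)
      also have "\<dots> = - (real (m - 1) * \<epsilon>)"
        using that by simp
      finally show ?thesis by simp
    qed
    also have "1 - real (m - 1) * \<epsilon> < 0"
      by (simp add: m_def \<epsilon>_def field_simps)
    finally have "(\<Sum>i<m. \<Sum>j<m. Q \<omega> (i, j)) < (\<Sum>i<m. 0)"
      by (intro sum_strict_mono) (simp_all add: m_def lessThan_empty_iff)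
    with R show False by simp
  qed
qed measurable

text \<open>Duplicating the three replicas m times each gives clusters whose barycentres X, Y, Z satisfy
  \<open>\<parallel>Y - Z\<parallel>\<^sup>2 \<approx> 0\<close> although \<open>X \<bullet> Y\<close> and \<open>X \<bullet> Z\<close> differ by at least \<open>\<delta>\<close>; positivity of the quadratic form at
  \<open>Y - Z + (\<delta>/2) X\<close> is then violated.\<close>
lemma ultrametric_aux:
  "AE \<omega> in M. \<not> (Q \<omega> (0, 1) < Q \<omega> (0, 2) \<and> Q \<omega> (0, 2) \<le> Q \<omega> (1, 2))"
proof (rule ccontr)
  assume "\<not> ?thesis"
  then have "\<P>(\<omega> in M. Q \<omega> (0, 1) < Q \<omega> (0, 2) \<and> Q \<omega> (0, 2) \<le> Q \<omega> (1, 2)) \<noteq> 0"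
    by (subst prob_Collect_eq_0) auto
  then have "0 < \<P>(\<omega> in M. Q \<omega> (0, 1) < Q \<omega> (0, 2) \<and> Q \<omega> (0, 2) \<le> Q \<omega> (1, 2))"
    by (simp add: zero_less_measure_iff)
  moreover have "\<exists>k. Q \<omega> (0, 1) + 1 / real (Suc k) < Q \<omega> (0, 2) \<and> Q \<omega> (0, 2) \<le> Q \<omega> (1, 2)"
    if *: "Q \<omega> (0, 1) < Q \<omega> (0, 2) \<and> Q \<omega> (0, 2) \<le> Q \<omega> (1, 2)" for \<omega>
  proof -
    obtain k where "inverse (real (Suc k)) < Q \<omega> (0, 2) - Q \<omega> (0, 1)"
      using reals_Archimedean[of "Q \<omega> (0, 2) - Q \<omega> (0, 1)"] * by auto
    then show ?thesis using that by (intro exI[of _ k]) (simp add: inverse_eq_divide)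
  qed
  ultimately have "\<exists>k. 0 < \<P>(\<omega> in M. Q \<omega> (0, 1) + 1 / real (Suc k) < Q \<omega> (0, 2) \<and> Q \<omega> (0, 2) \<le> Q \<omega> (1, 2))"
    by (intro ex_prob_pos[of "\<lambda>\<omega>. Q \<omega> (0, 1) < Q \<omega> (0, 2) \<and> Q \<omega> (0, 2) \<le> Q \<omega> (1, 2)"]) auto
  then obtain k where k:
    "0 < \<P>(\<omega> in M. Q \<omega> (0, 1) + 1 / real (Suc k) < Q \<omega> (0, 2) \<and> Q \<omega> (0, 2) \<le> Q \<omega> (1, 2))"
    by blast
  define \<delta> where "\<delta> = 1 / real (Suc k)"
  \<comment> \<open>With this grid width the cell errors
    \<open>2 * \<eta> + \<delta> * \<eta>\<close> are at most 3/16 of the square of \<delta>,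
    against a gain of 3/4 of that square in the quadratic form.\<close>
  define \<eta> where "\<eta> = \<delta>\<^sup>2 / 16"
  have \<delta>: "0 < \<delta>" "\<delta> \<le> 1" by (auto simp: \<delta>_def)
  have \<eta>: "0 < \<eta>" using \<delta> by (simp add: \<eta>_def)
  define cell where "cell u = {of_int u * \<eta>..<of_int u * \<eta> + \<eta>}" for u :: int
  have "\<exists>uv. 0 < \<P>(\<omega> in M. Q \<omega> (0, 1) + \<delta> < Q \<omega> (0, 2) \<and> Q \<omega> (0, 2) \<le> Q \<omega> (1, 2)
      \<and> Q \<omega> (0, 2) \<in> cell (fst uv) \<and> Q \<omega> (1, 2) \<in> cell (snd uv))"
  proof (rule ex_prob_pos)
    have "x \<in> cell \<lfloor>x / \<eta>\<rfloor>" for x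
    proof -
      have "of_int \<lfloor>x / \<eta>\<rfloor> \<le> x / \<eta>" "x / \<eta> < of_int \<lfloor>x / \<eta>\<rfloor> + 1" by linarith+
      then have "of_int \<lfloor>x / \<eta>\<rfloor> * \<eta> \<le> x" "x < (of_int \<lfloor>x / \<eta>\<rfloor> + 1) * \<eta>"
        using \<eta> by (simp_all only: pos_le_divide_eq pos_divide_less_eq)
      then show ?thesis by (simp add: cell_def algebra_simps)
    qed
    then show "AE \<omega> in M. Q \<omega> (0, 1) + \<delta> < Q \<omega> (0, 2) \<and> Q \<omega> (0, 2) \<le> Q \<omega> (1, 2) \<longrightarrow>
      (\<exists>uv. Q \<omega> (0, 1) + \<delta> < Q \<omega> (0, 2) \<and> Q \<omega> (0, 2) \<le> Q \<omega> (1, 2)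
      \<and> Q \<omega> (0, 2) \<in> cell (fst uv) \<and> Q \<omega> (1, 2) \<in> cell (snd uv))"
      by (auto intro!: AE_I2)
  qed (use k in \<open>auto simp: \<delta>_def cell_def\<close>)
  then obtain u v where uv:
    "0 < \<P>(\<omega> in M. Q \<omega> (0, 1) + \<delta> < Q \<omega> (0, 2) \<and> Q \<omega> (0, 2) \<le> Q \<omega> (1, 2)
      \<and> Q \<omega> (0, 2) \<in> cell u \<and> Q \<omega> (1, 2) \<in> cell v)"
    by auto
  define b where "b = of_int u * \<eta>"
  define c where "c = of_int v * \<eta>"
  have cells: "cell u = {b..<b + \<eta>}" "cell v = {c..<c + \<eta>}"
    by (auto simp: cell_def b_def c_def)
  \<comment> \<open>One outcome in the event suffices: its overlaps order the two cells, giving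
    \<open>b \<le> c\<close>, and bound \<open>c + \<eta>\<close> below by -1, which the diagonal
    entries require later.\<close>
  obtain \<omega> where "Q \<omega> (0, 2) \<le> Q \<omega> (1, 2)" "Q \<omega> (0, 2) \<in> cell u" "Q \<omega> (1, 2) \<in> cell v"
      "-1 \<le> Q \<omega> (1, 2)"
    by (rule prob_pos_witness[OF _ uv Q_bounds[of 1 2]]) (auto simp: cell_def)
  then have c: "-1 \<le> c + \<eta>" and "of_int u * \<eta> < of_int (v + 1) * \<eta>"
    unfolding cells by (auto simp: b_def c_def algebra_simps)
  then have "(of_int u :: real) < of_int (v + 1)"
    using \<eta> by (simp only: mult_less_cancel_right_pos)
  then have "u \<le> v" by linarith
  then have bc: "b \<le> c" using \<eta> by (simp add: b_def c_def)
  define t where "t p = (if p = 0 then b + \<eta> else c + \<eta>)" for p :: nat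
  \<comment> \<open>The guard \<open>0 < p \<and> 0 < q\<close> keeps the pair 0, 3 out of the last
    interval, which need not lie below \<open>t 0\<close>; the empty default lies below every
    threshold.\<close>
  define V where "V p q = (if p = q then {..<t p} else if p + q = 1 then {..<b + \<eta> - \<delta>}
    else if p + q = 2 then {b..<b + \<eta>} else if p + q = 3 \<and> 0 < p \<and> 0 < q then {c..<c + \<eta>} else {})"
    for p q :: nat
  have V [measurable]: "V p q \<in> sets borel" for p q by (simp add: V_def)
  have below: "V p q \<subseteq> {..<t p}" for p q
    using bc \<delta> by (auto simp: V_def t_def)
  have diag: "V p p = {..<t p}" for p by (simp add: V_def)
  have "AE \<omega> in M. Q \<omega> (0, 1) + \<delta> < Q \<omega> (0, 2) \<and> Q \<omega> (0, 2) \<le> Q \<omega> (1, 2)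
      \<and> Q \<omega> (0, 2) \<in> cell u \<and> Q \<omega> (1, 2) \<in> cell v \<longrightarrow> Q \<omega> \<in> overlap_box V (\<lambda>i. i mod 3) 3"
    using symmetric[of 0 1] symmetric[of 0 2] symmetric[of 1 2]
  proof eventually_elim
    case (elim \<omega>)
    have three: "(\<forall>a<3. P a) \<longleftrightarrow> P 0 \<and> P 1 \<and> P 2" for P :: "nat \<Rightarrow> bool"
      by (simp add: numeral_3_eq_3 numeral_2_eq_2 All_less_Suc2)
    show ?case
      unfolding overlap_box_def mem_Collect_eq three
      using elim by (simp add: V_def cells)
  qed
  then have "\<P>(\<omega> in M. Q \<omega> (0, 1) + \<delta> < Q \<omega> (0, 2) \<and> Q \<omega> (0, 2) \<le> Q \<omega> (1, 2)
      \<and> Q \<omega> (0, 2) \<in> cell u \<and> Q \<omega> (1, 2) \<in> cell v) \<le> \<P>(\<omega> in M. Q \<omega> \<in> overlap_box V (\<lambda>i. i mod 3) 3)"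
    by (intro finite_measure_mono_AE) auto
  with uv have pos: "0 < \<P>(\<omega> in M. Q \<omega> \<in> overlap_box V (\<lambda>i. i mod 3) 3)"
    by simp
  \<comment> \<open>The quadratic form will be at most \<open>6 * m\<close> minus half the square of
    \<open>m * \<delta>\<close>, hence negative for this \<open>m\<close>.\<close>
  obtain m :: nat where m: "12 / \<delta>\<^sup>2 < real m" "0 < m"
    using reals_Archimedean2[of "max 1 (12 / \<delta>\<^sup>2)"] by force
  define \<kappa> where "\<kappa> i = (if i = 0 then \<delta> / 2 else if i = 1 then 1 else - 1)" for i :: nat
  have le1: "AE \<omega> in M. i \<noteq> j \<longrightarrow> Q \<omega> (i, j) \<le> 1" for i j
    using Q_bounds[of i j] by (cases "i = j") auto
  have "0 < \<P>(\<omega> in M. Q \<omega> \<in> overlap_box V (\<lambda>i. i mod 3) (3 * m))"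
    using m by (intro box_periodic[OF V below diag _ _ _ _ pos]) auto
  moreover have "AE \<omega> in M. (\<forall>i\<in>{..<3 * m}. Q \<omega> (i, i) = 1)
      \<and> (\<forall>i\<in>{..<3 * m}. \<forall>j\<in>{..<3 * m}. i \<noteq> j \<longrightarrow> Q \<omega> (i, j) \<le> 1)
      \<and> 0 \<le> (\<Sum>i<3 * m. \<Sum>j<3 * m. \<kappa> (i mod 3) * \<kappa> (j mod 3) * Q \<omega> (i, j))"
    by (intro AE_conjI AE_finite_allI diagonal positive_semidefinite le1) simp_all
  ultimately obtain \<omega> where box: "Q \<omega> \<in> overlap_box V (\<lambda>i. i mod 3) (3 * m)"
      and R: "(\<forall>i\<in>{..<3 * m}. Q \<omega> (i, i) = 1)
      \<and> (\<forall>i\<in>{..<3 * m}. \<forall>j\<in>{..<3 * m}. i \<noteq> j \<longrightarrow> Q \<omega> (i, j) \<le> 1)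
      \<and> 0 \<le> (\<Sum>i<3 * m. \<Sum>j<3 * m. \<kappa> (i mod 3) * \<kappa> (j mod 3) * Q \<omega> (i, j))"
    by (rule prob_pos_witness[rotated]) (use that in blast, measurable)
  have \<omega>: "Q \<omega> (i, i) = 1" "j < 3 * m \<Longrightarrow> i \<noteq> j \<Longrightarrow> Q \<omega> (i, j) \<le> 1" if "i < 3 * m" for i j
    using R that by blast+
  \<comment> \<open>\<open>B\<close> bounds the weighted entries off the diagonal: each cell
    contributes the end selected by the sign of the coefficients, while two copies of type 0 use
    only that overlaps are at most 1.\<close>
  define B where "B p q = (if p = q then if p = 0 then (\<delta> / 2)\<^sup>2 else c + \<eta>
    else if p + q = 1 then \<delta> / 2 * (b + \<eta> - \<delta>) else if p + q = 2 then - (\<delta> / 2 * b) else - c)"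
    for p q :: nat
  have entry_off: "\<kappa> p * \<kappa> q * x \<le> B p q" if pq: "p < 3" "q < 3" and x: "x \<in> V p q" "x \<le> 1" for p q x
  proof -
    have mono: "\<delta> / 2 * y \<le> \<delta> / 2 * z" if "y \<le> z" for y z
      using that \<delta> by (intro mult_left_mono) auto
    have "(\<delta> / 2)\<^sup>2 * x \<le> (\<delta> / 2)\<^sup>2 * 1"
      using x by (intro mult_left_mono) auto
    then have sq: "\<delta> * (\<delta> * x) / 4 \<le> (\<delta> / 2)\<^sup>2" by (simp add: power2_eq_square)
    consider "p = 0" "q = 0" | "p = 0" "q = 1" | "p = 0" "q = 2"
      | "p = 1" "q = 0" | "p = 1" "q = 1" | "p = 1" "q = 2"
      | "p = 2" "q = 0" | "p = 2" "q = 1" | "p = 2" "q = 2"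
    proof -
      have "p = 0 \<or> p = 1 \<or> p = 2" "q = 0 \<or> q = 1 \<or> q = 2" using pq by linarith+
      then show ?thesis by (elim disjE) (rule that; assumption)+
    qed
    then show ?thesis
    proof cases
      case 1 then show ?thesis using sq by (simp add: \<kappa>_def B_def)
    next
      case 2 then show ?thesis using x mono[of x "b + \<eta> - \<delta>"] by (simp add: \<kappa>_def B_def V_def)
    next
      case 3 then show ?thesis using x mono[of b x] by (simp add: \<kappa>_def B_def V_def)
    next
      case 4 then show ?thesis using x mono[of x "b + \<eta> - \<delta>"] by (simp add: \<kappa>_def B_def V_def)
    next
      case 7 then show ?thesis using x mono[of b x] by (simp add: \<kappa>_def B_def V_def)
    qed (use x in \<open>simp_all add: \<kappa>_def B_def V_def t_def\<close>)
  qed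
  \<comment> \<open>A self-overlap is 1 and need not respect the threshold of its type; by
    \<open>-1 \<le> c + \<eta>\<close> an extra 2 covers the excess. These \<open>3 * m\<close>
    corrections are only linear in \<open>m\<close>.\<close>
  have entry: "\<kappa> (i mod 3) * \<kappa> (j mod 3) * Q \<omega> (i, j) \<le> B (i mod 3) (j mod 3) + (if i = j then 2 else 0)"
    if ij: "i < 3 * m" "j < 3 * m" for i j
  proof (cases "i = j")
    case True
    then show ?thesis
      using \<omega>(1) ij c by (auto simp: \<kappa>_def B_def power2_eq_square)
  next
    case False
    then have mem: "Q \<omega> (i, j) \<in> V (i mod 3) (j mod 3)" and le1: "Q \<omega> (i, j) \<le> 1"
      using box \<omega>(2) ij by (auto simp: overlap_box_def)
    then show ?thesis
      using False entry_off[OF _ _ mem le1] by simp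
  qed
  have period: "(\<Sum>i<3 * n. f (i mod 3)) = real n * (f 0 + f 1 + f 2)" for f :: "nat \<Rightarrow> real" and n
  proof (induction n)
    case (Suc n)
    have *: "3 * Suc n = Suc (Suc (Suc (3 * n)))" by simp
    have **: "3 * n mod 3 = 0" "Suc (3 * n) mod 3 = 1" "Suc (Suc (3 * n)) mod 3 = 2" by presburger+
    show ?case
      unfolding * sum.lessThan_Suc Suc ** by (simp add: algebra_simps)
  qed simp
  have "(\<Sum>i<3 * m. \<Sum>j<3 * m. \<kappa> (i mod 3) * \<kappa> (j mod 3) * Q \<omega> (i, j))
      \<le> (\<Sum>i<3 * m. \<Sum>j<3 * m. B (i mod 3) (j mod 3) + (if i = j then 2 else 0))"
    by (intro sum_mono entry) auto
  also have "\<dots> = (\<Sum>i<3 * m. (\<Sum>j<3 * m. B (i mod 3) (j mod 3))) + (\<Sum>i<3 * m. 2)"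
    by (simp add: sum.distrib)
  also have "(\<Sum>i<3 * m. (\<Sum>j<3 * m. B (i mod 3) (j mod 3)))
      = (\<Sum>i<3 * m. real m * (B (i mod 3) 0 + B (i mod 3) 1 + B (i mod 3) 2))"
    by (intro sum.cong refl period)
  also have "\<dots> = real m * (real m * (B 0 0 + B 0 1 + B 0 2) + real m * (B 1 0 + B 1 1 + B 1 2)
      + real m * (B 2 0 + B 2 1 + B 2 2))"
    by (rule period[of "\<lambda>i. real m * (B i 0 + B i 1 + B i 2)"])
  also have "\<dots> = (real m)\<^sup>2 * ((B 0 0 + B 0 1 + B 0 2) + (B 1 0 + B 1 1 + B 1 2) + (B 2 0 + B 2 1 + B 2 2))"
    by (simp only: power2_eq_square distrib_left mult.assoc)
  \<comment> \<open>The cross terms with type 0 contribute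
    \<open>\<delta> * (\<eta> - \<delta>)\<close>, the block of types 1 and 2 contributes
    \<open>2 * \<eta>\<close>, and type 0 itself the square of \<open>\<delta> / 2\<close>.\<close>
  also have "(B 0 0 + B 0 1 + B 0 2) + (B 1 0 + B 1 1 + B 1 2) + (B 2 0 + B 2 1 + B 2 2)
      = - (\<delta>\<^sup>2) * (5 / 8 - \<delta> / 16)"
    by (simp add: B_def \<eta>_def power2_eq_square field_simps)
  also have "(real m)\<^sup>2 * (- (\<delta>\<^sup>2) * (5 / 8 - \<delta> / 16)) \<le> (real m)\<^sup>2 * (- (\<delta>\<^sup>2) * (1 / 2))"
    using \<delta> by (intro mult_left_mono mult_left_mono_neg) auto
  also have "(\<Sum>i<3 * m. 2) = 6 * real m" by simp
  finally have "0 \<le> (real m)\<^sup>2 * (- (\<delta>\<^sup>2) * (1 / 2)) + 6 * real m"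
    using R by simp
  then have "0 \<le> real m * (6 - real m * \<delta>\<^sup>2 / 2)"
    by (simp add: power2_eq_square algebra_simps)
  then have "real m * \<delta>\<^sup>2 \<le> 12"
    using m by (simp add: zero_le_mult_iff)
  with m \<delta> show False by (simp add: field_simps)
qed

text \<open>The excluded ordering and its image under the swap of replicas 0 and 1 give the first
  inequality; exchangeability gives the others.\<close>

lemma ultrametric:
  "AE \<omega> in M. min (Q \<omega> (0, 2)) (Q \<omega> (1, 2)) \<le> Q \<omega> (0, 1)"
  "AE \<omega> in M. min (Q \<omega> (0, 1)) (Q \<omega> (1, 2)) \<le> Q \<omega> (0, 2)"
  "AE \<omega> in M. min (Q \<omega> (0, 1)) (Q \<omega> (0, 2)) \<le> Q \<omega> (1, 2)"
proof -
  have perm: "Transposition.transpose i j permutes {..<3::nat}" if "i < 3" "j < 3" for i j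
    using that by (intro permutes_swap_id) auto
  have meas: "Measurable.pred arrays
      (\<lambda>x :: nat \<times> nat \<Rightarrow> real. \<not> (x (0, 1) < x (0, 2) \<and> x (0, 2) \<le> x (1, 2)))"
    "Measurable.pred arrays (\<lambda>x :: nat \<times> nat \<Rightarrow> real. min (x (0, 2)) (x (1, 2)) \<le> x (0, 1))"
    by (unfold min_le_iff_disj not_less[symmetric]) measurable
  have "AE \<omega> in M. \<not> (Q \<omega> (1, 0) < Q \<omega> (1, 2) \<and> Q \<omega> (1, 2) \<le> Q \<omega> (0, 2))"
    using AE_exchange[OF perm[of 0 1] meas(1) ultrametric_aux] by simp
  with ultrametric_aux symmetric[of 0 1]
  show base: "AE \<omega> in M. min (Q \<omega> (0, 2)) (Q \<omega> (1, 2)) \<le> Q \<omega> (0, 1)"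
    by eventually_elim auto
  have "AE \<omega> in M. min (Q \<omega> (0, 1)) (Q \<omega> (2, 1)) \<le> Q \<omega> (0, 2)"
    using AE_exchange[OF perm[of 1 2] meas(2) base] by simp
  with symmetric[of 1 2] show "AE \<omega> in M. min (Q \<omega> (0, 1)) (Q \<omega> (1, 2)) \<le> Q \<omega> (0, 2)"
    by eventually_elim auto
  have "AE \<omega> in M. min (Q \<omega> (2, 0)) (Q \<omega> (1, 0)) \<le> Q \<omega> (2, 1)"
    using AE_exchange[OF perm[of 0 2] meas(2) base] by simp
  with symmetric[of 1 2] symmetric[of 0 2] symmetric[of 0 1]
  show "AE \<omega> in M. min (Q \<omega> (0, 1)) (Q \<omega> (0, 2)) \<le> Q \<omega> (1, 2)"
    by eventually_elim auto
qed

end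

subsection \<open>Lipschitz extension and laws on metric spaces\<close>

text \<open>McShane's supremum formula with a one-sided penalty: only points with
  \<open>g x > q\<close> are penalised, so the extension is monotone besides being Lipschitz.
  Truncation at 0 keeps the range, and \<open>incr\<close> says that no point exceeds
  \<open>h y\<close> at \<open>g y\<close>, whence agreement on \<open>D\<close>.\<close>

lemma monotone_lipschitz_extension:
  fixes g h :: "'i \<Rightarrow> real"
  assumes "D \<noteq> {}" "0 \<le> K"
    and h01: "\<And>x. x \<in> D \<Longrightarrow> h x \<in> {0..1}"
    and incr: "\<And>x y. x \<in> D \<Longrightarrow> y \<in> D \<Longrightarrow> h y - h x \<le> K * max 0 (g y - g x)"
  shows "\<exists>L. mono_on {0..1} L \<and> L ` {0..1} \<subseteq> {0..1} \<and> K-lipschitz_on {0..1} L \<and>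
    (\<forall>x\<in>D. L (g x) = h x)"
proof -
  define F where "F q = (SUP x\<in>D. h x - K * max 0 (g x - q))" for q
  define L where "L q = max 0 (F q)" for q
  have term_le: "h x - K * max 0 (g x - q) \<le> 1" if "x \<in> D" for x q
  proof -
    have "0 \<le> K * max 0 (g x - q)" using \<open>0 \<le> K\<close> by simp
    then show ?thesis using h01[OF that] by simp
  qed
  have bdd: "bdd_above ((\<lambda>x. h x - K * max 0 (g x - q)) ` D)" for q
    using term_le by (intro bdd_aboveI2)
  \<comment> \<open>For \<open>q' \<le> q\<close> this is monotonicity, for \<open>q' > q\<close>
    the Lipschitz bound.\<close>
  have shift: "F q' \<le> F q + K * max 0 (q' - q)" for q q'
    unfolding F_def[of q']
  proof (rule cSUP_least[OF \<open>D \<noteq> {}\<close>])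
    fix x assume x: "x \<in> D"
    have "max 0 (g x - q) \<le> max 0 (g x - q') + max 0 (q' - q)" by simp
    then have "K * max 0 (g x - q) \<le> K * (max 0 (g x - q') + max 0 (q' - q))"
      using \<open>0 \<le> K\<close> by (rule mult_left_mono)
    moreover have "h x - K * max 0 (g x - q) \<le> F q"
      unfolding F_def by (rule cSUP_upper[OF x bdd])
    ultimately show "h x - K * max 0 (g x - q') \<le> F q + K * max 0 (q' - q)"
      by (simp add: distrib_left)
  qed
  have "F q \<le> 1" for q
    unfolding F_def using term_le by (rule cSUP_least[OF \<open>D \<noteq> {}\<close>])
  then have range: "L ` {0..1} \<subseteq> {0..1}" by (auto simp: L_def)
  have "mono_on {0..1} L"
  proof (rule mono_onI)
    fix r s :: real assume "r \<le> s"
    then show "L r \<le> L s" using shift[of r s] by (auto simp: L_def)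
  qed
  moreover have "K-lipschitz_on {0..1} L"
  proof (rule lipschitz_onI)
    fix x y :: real
    have "max 0 (x - y) \<le> \<bar>x - y\<bar>" "max 0 (y - x) \<le> \<bar>x - y\<bar>" by simp_all
    then have "K * max 0 (x - y) \<le> K * \<bar>x - y\<bar>" "K * max 0 (y - x) \<le> K * \<bar>x - y\<bar>"
      using \<open>0 \<le> K\<close> by (simp_all only: mult_left_mono)
    moreover have "0 \<le> K * \<bar>x - y\<bar>" using \<open>0 \<le> K\<close> by simp
    ultimately show "dist (L x) (L y) \<le> K * dist x y"
      using shift[of x y] shift[of y x] unfolding L_def dist_real_def by linarith
  qed fact
  moreover have "L (g y) = h y" if y: "y \<in> D" for y
  proof -
    have "F (g y) \<le> h y"
      unfolding F_def using incr[OF y] by (intro cSUP_least[OF \<open>D \<noteq> {}\<close>]) (simp add: algebra_simps)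
    moreover have "h y - K * max 0 (g y - g y) \<le> F (g y)"
      unfolding F_def by (rule cSUP_upper[OF y bdd])
    ultimately show ?thesis using h01[OF y] by (simp add: L_def)
  qed
  ultimately show ?thesis using range by blast
qed

text \<open>Closed sets form an intersection-stable generator, and the indicator of a nonempty
  closed set is a bounded limit of continuous functions of the distance to it.\<close>

lemma finite_borel_measure_eqI:
  fixes \<mu> \<nu> :: "'a :: metric_space measure"
  assumes "finite_measure \<mu>" "finite_measure \<nu>"
    and sets: "sets \<mu> = sets borel" "sets \<nu> = sets borel"
    and eq: "\<And>h :: 'a \<Rightarrow> real. continuous_on UNIV h \<Longrightarrow> (\<And>x. 0 \<le> h x \<and> h x \<le> 1) \<Longrightarrow>
      (\<integral>x. h x \<partial>\<mu>) = (\<integral>x. h x \<partial>\<nu>)"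
  shows "\<mu> = \<nu>"
proof (rule measure_eqI_generator_eq[where E = "Collect closed" and \<Omega> = UNIV and A = "\<lambda>_. UNIV"])
  interpret \<mu>: finite_measure \<mu> by fact
  interpret \<nu>: finite_measure \<nu> by fact
  show "Int_stable (Collect closed :: 'a set set)"
    by (auto simp: Int_stable_def)
  show "sets \<mu> = sigma_sets UNIV (Collect closed)" "sets \<nu> = sigma_sets UNIV (Collect closed)"
    by (simp_all add: sets borel_eq_closed)
  fix C :: "'a set" assume "C \<in> Collect closed"
  then have C: "closed C" by simp
  show "emeasure \<mu> C = emeasure \<nu> C"
  \<comment> \<open>\<open>infdist\<close> to the empty set is 0 by convention, so the approximating
    functions would be constantly 1 there.\<close>
  proof (cases "C = {}")
    case False
    define h where "h k x = max 0 (1 - real k * infdist x C)" for k x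
    have cont: "continuous_on UNIV (h k)" for k
      unfolding h_def by (intro continuous_intros)
    have h01: "0 \<le> h k x \<and> h k x \<le> 1" for k x
      by (simp add: h_def infdist_nonneg)
    have lim: "(\<lambda>k. h k x) \<longlonglongrightarrow> indicator C x" for x
    proof (cases "x \<in> C")
      case True
      then show ?thesis using False by (simp add: h_def)
    next
      case nin: False
      then have pos: "0 < infdist x C"
        using C False by (metis in_closed_iff_infdist_zero infdist_nonneg less_le)
      obtain n where n: "1 < real n * infdist x C"
        using ex_less_of_nat_mult[OF pos] by auto
      have "h k x = 0" if "n \<le> k" for k
      proof -
        have "real n * infdist x C \<le> real k * infdist x C"
          using that pos by (intro mult_right_mono) auto
        then show ?thesis using n by (simp add: h_def)
      qed
      then have "eventually (\<lambda>k. h k x = 0) sequentially"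
        unfolding eventually_sequentially by blast
      then show ?thesis using nin by (simp add: tendsto_eventually)
    qed
    have conv: "(\<lambda>k. \<integral>x. h k x \<partial>\<rho>) \<longlonglongrightarrow> measure \<rho> C"
      if "finite_measure \<rho>" and [measurable_cong]: "sets \<rho> = sets borel" for \<rho>
    proof -
      interpret \<rho>: finite_measure \<rho> by fact
      have [measurable]: "h k \<in> borel_measurable borel" for k
        by (rule borel_measurable_continuous_onI[OF cont])
      have [measurable]: "C \<in> sets borel" using C by simp
      have "(\<lambda>k. \<integral>x. h k x \<partial>\<rho>) \<longlonglongrightarrow> (\<integral>x. indicator C x \<partial>\<rho>)"
        by (rule integral_dominated_convergence[where w = "\<lambda>_. 1"])
          (use h01 lim in \<open>auto intro: AE_I2\<close>)
      then show ?thesis using that C by (simp add: sets_eq_imp_space_eq[OF that(2)])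
    qed
    have "(\<lambda>k. \<integral>x. h k x \<partial>\<mu>) = (\<lambda>k. \<integral>x. h k x \<partial>\<nu>)"
      using eq[OF cont h01] by simp
    then have "measure \<mu> C = measure \<nu> C"
      using conv[OF assms(1) sets(1)] conv[OF assms(2) sets(2)] by (metis LIMSEQ_unique)
    then show ?thesis
      by (simp add: \<mu>.emeasure_eq_measure \<nu>.emeasure_eq_measure)
  qed simp
qed (use assms in \<open>auto simp: finite_measure.emeasure_finite\<close>)

text \<open>By Lindelof's theorem the union of all null open sets is the union of countably many of
  them, hence almost surely avoided.\<close>

lemma (in prob_space) AE_in_support:
  fixes X :: "'a \<Rightarrow> 'b :: second_countable_topology"
  assumes [measurable]: "X \<in> borel_measurable M"
  shows "AE \<omega> in M. X \<omega> \<in> {x. \<forall>U. open U \<longrightarrow> x \<in> U \<longrightarrow> 0 < \<P>(\<omega> in M. X \<omega> \<in> U)}"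
proof -
  define \<F> where "\<F> = {U :: 'b set. open U \<and> \<P>(\<omega> in M. X \<omega> \<in> U) = 0}"
  obtain \<F>' where \<F>': "\<F>' \<subseteq> \<F>" "countable \<F>'" "\<Union>\<F>' = \<Union>\<F>"
    using Lindelof[of \<F>] by (auto simp: \<F>_def)
  have "AE \<omega> in M. \<forall>U\<in>\<F>'. X \<omega> \<notin> U"
  proof (rule AE_ball_countable'[OF _ \<F>'(2)])
    fix U assume "U \<in> \<F>'"
    then have U: "open U" "\<P>(\<omega> in M. X \<omega> \<in> U) = 0" using \<F>' by (auto simp: \<F>_def)
    have [measurable]: "U \<in> sets borel" using U by simp
    show "AE \<omega> in M. X \<omega> \<notin> U" using U(2) by (subst (asm) prob_Collect_eq_0) auto
  qed
  then show ?thesis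
  proof eventually_elim
    case (elim \<omega>)
    then have "X \<omega> \<notin> \<Union>\<F>" using \<F>'(3) by blast
    then show ?case by (auto simp: \<F>_def zero_less_measure_iff)
  qed
qed

subsection \<open>Limits of overlap arrays\<close>

definition relabel :: "nat \<Rightarrow> (nat \<Rightarrow> nat) \<Rightarrow> ('s \<times> nat \<times> nat \<Rightarrow> real) \<Rightarrow> 's \<times> nat \<times> nat \<Rightarrow> real" where
  "relabel n \<pi> x = (\<lambda>(s, l, l') \<in> arr_idx n. x (s, \<pi> l, \<pi> l'))"

lemma relabel_corner:
  assumes "\<pi> permutes {..<n}"
  shows "relabel n \<pi> (corner n X) = corner n (\<lambda>s l l'. X s (\<pi> l) (\<pi> l'))"
proof -
  have "\<pi> l < n \<longleftrightarrow> l < n" for l using permutes_in_image[OF assms, of l] by simp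
  then show ?thesis by (auto simp: relabel_def corner_def arr_idx_def fun_eq_iff)
qed

text \<open>Replicas are independent and identically distributed given the Gibbs measure: reindexing
  configurations by \<pi> permutes the factors of the product weight and relabels the overlap
  array.\<close>

lemma annealed_relabel:
  assumes \<pi>: "\<pi> permutes {..<n}"
  shows "annealed P G N I n (\<lambda>x. h (relabel n \<pi> x)) = annealed P G N I n h"
proof -
  have less: "\<pi> l < n \<longleftrightarrow> l < n" for l using permutes_in_image[OF \<pi>, of l] by simp
  have inv: "inv \<pi> permutes {..<n}" by (rule permutes_inv[OF \<pi>])
  have less': "inv \<pi> l < n \<longleftrightarrow> l < n" for l using permutes_in_image[OF inv, of l] by simp
  define S where "S = PiE {..<n} (\<lambda>_. Pow {..<N})"
  define T where "T g \<omega> \<sigma> = (\<Prod>l<n. G \<omega> (\<sigma> l)) *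
    g (\<lambda>(s, l, l') \<in> arr_idx n. overlap (I s) (\<sigma> l) (\<sigma> l'))" for g \<omega> \<sigma>
  have compose: "\<sigma> \<circ> \<pi> \<in> S" if "\<sigma> \<in> S" "\<pi> permutes {..<n}" for \<sigma> \<pi>
    using that permutes_in_image[OF that(2)] permutes_not_in[OF that(2)]
    by (auto simp: S_def PiE_def extensional_def Pi_def)
  have "(\<Sum>\<sigma>\<in>S. T (\<lambda>x. h (relabel n \<pi> x)) \<omega> \<sigma>) = (\<Sum>\<sigma>\<in>S. T h \<omega> \<sigma>)" for \<omega>
  proof (rule sum.reindex_bij_witness[where i = "\<lambda>\<sigma>. \<sigma> \<circ> inv \<pi>" and j = "\<lambda>\<sigma>. \<sigma> \<circ> \<pi>"])
    fix \<sigma> assume "\<sigma> \<in> S"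
    show "\<sigma> \<circ> \<pi> \<circ> inv \<pi> = \<sigma>" "\<sigma> \<circ> inv \<pi> \<circ> \<pi> = \<sigma>"
      using permutes_inv_o[OF \<pi>] by (simp_all add: comp_assoc)
    show "\<sigma> \<circ> \<pi> \<in> S" "\<sigma> \<circ> inv \<pi> \<in> S"
      using compose \<open>\<sigma> \<in> S\<close> \<pi> inv by auto
    have "(\<Prod>l<n. G \<omega> (\<sigma> (\<pi> l))) = (\<Prod>l<n. G \<omega> (\<sigma> l))"
      using prod.permute[OF \<pi>, of "\<lambda>l. G \<omega> (\<sigma> l)"] by (simp add: comp_def)
    moreover have "relabel n \<pi> (\<lambda>(s, l, l') \<in> arr_idx n. overlap (I s) (\<sigma> l) (\<sigma> l'))
        = (\<lambda>(s, l, l') \<in> arr_idx n. overlap (I s) (\<sigma> (\<pi> l)) (\<sigma> (\<pi> l')))"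
      using less by (auto simp: relabel_def arr_idx_def fun_eq_iff)
    ultimately show "T h \<omega> (\<sigma> \<circ> \<pi>) = T (\<lambda>x. h (relabel n \<pi> x)) \<omega> \<sigma>"
      by (simp add: T_def)
  qed
  then show ?thesis by (simp add: annealed_def S_def T_def)
qed

locale overlap_limit_array = prob_space M
  for M :: "'m measure" +
  fixes lam :: "'s :: finite \<Rightarrow> real" and R :: "'m \<Rightarrow> 's \<Rightarrow> nat \<Rightarrow> nat \<Rightarrow> real"
    and N :: "nat \<Rightarrow> nat" and I :: "nat \<Rightarrow> 's \<Rightarrow> nat set"
    and P :: "nat \<Rightarrow> 'w measure" and G :: "nat \<Rightarrow> 'w \<Rightarrow> nat set \<Rightarrow> real"
  assumes lam_pos: "\<And>s. 0 < lam s"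
    and R_measurable [measurable]: "\<And>s l l'. (\<lambda>\<omega>. R \<omega> s l l') \<in> borel_measurable M"
    and limit: "overlap_limit lam M R N I P G"
begin

lemma measurable_corner [measurable]: "(\<lambda>\<omega>. corner n (R \<omega>)) \<in> borel_measurable M"
proof (rule measurable_coordinatewise_then_product)
  fix i :: "'s \<times> nat \<times> nat"
  show "(\<lambda>\<omega>. corner n (R \<omega>) i) \<in> borel_measurable M"
    by (cases i; cases "i \<in> arr_idx n") (auto simp: corner_def)
qed

lemma limit_integral:
  assumes "continuous_on UNIV h" "\<And>x. 0 \<le> h x \<and> h x \<le> (1 :: real)"
  shows "(\<lambda>k. annealed (P k) (G k) (N k) (I k) n h) \<longlonglongrightarrow> (\<integral>\<omega>. h (corner n (R \<omega>)) \<partial>M)"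
proof -
  have "continuous_on (arr_space n) h"
    using assms(1) by (rule continuous_on_subset) simp
  moreover have "bounded (h ` arr_space n)"
    using assms(2) by (intro boundedI[where B = 1]) auto
  ultimately show ?thesis using limit by (simp add: overlap_limit_def)
qed

section \<open>Almost sure constraints and exchangeability in the limit\<close>

text \<open>Closed conditions pass to the limit. The truncated negative part of \<open>p\<close> is
  an admissible test function whose annealed expectation vanishes eventually, so its limit
  expectation is 0.\<close>

lemma AE_corner_nonneg:
  fixes p :: "('s \<times> nat \<times> nat \<Rightarrow> real) \<Rightarrow> real"
  assumes cont: "continuous_on UNIV p"
    and nonneg: "\<And>J \<sigma>. (\<And>s. finite (J s) \<and> J s \<noteq> {}) \<Longrightarrow>
      0 \<le> p (\<lambda>(s, l, l') \<in> arr_idx n. overlap (J s) (\<sigma> l) (\<sigma> l'))"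
  shows "AE \<omega> in M. 0 \<le> p (corner n (R \<omega>))"
proof -
  define h where "h x = min 1 (max 0 (- p x))" for x
  have cont_h: "continuous_on UNIV h"
    unfolding h_def by (intro continuous_intros cont)
  have [measurable]: "h \<in> borel_measurable borel"
    by (rule borel_measurable_continuous_onI[OF cont_h])
  have h01: "0 \<le> h x \<and> h x \<le> 1" for x by (simp add: h_def)
  \<comment> \<open>An empty species has overlap 0 through division by zero, even with itself; the
    positive limiting proportions exclude this eventually.\<close>
  have "eventually (\<lambda>k. I k s \<noteq> {}) sequentially" for s
  proof -
    have "(\<lambda>k. real (card (I k s)) / real (N k)) \<longlonglongrightarrow> lam s"
      using limit by (simp add: overlap_limit_def)
    then have "eventually (\<lambda>k. 0 < real (card (I k s)) / real (N k)) sequentially"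
      using lam_pos by (rule order_tendstoD)
    then show ?thesis by eventually_elim auto
  qed
  then have "eventually (\<lambda>k. \<forall>s. I k s \<noteq> {}) sequentially"
    by (rule eventually_all_finite)
  then have "eventually (\<lambda>k. annealed (P k) (G k) (N k) (I k) n h = 0) sequentially"
  proof eventually_elim
    case (elim k)
    have "(\<Union>s. I k s) = {..<N k}" using limit by (simp add: overlap_limit_def)
    then have "finite (I k s)" for s by (metis UN_upper UNIV_I finite_lessThan finite_subset)
    with elim have "h (\<lambda>(s, l, l') \<in> arr_idx n. overlap (I k s) (\<sigma> l) (\<sigma> l')) = 0" for \<sigma>
      using nonneg[of "I k" \<sigma>] by (simp add: h_def)
    then show ?case by (simp add: annealed_def)
  qed
  then have "(\<lambda>k. annealed (P k) (G k) (N k) (I k) n h) \<longlonglongrightarrow> 0"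
    by (rule tendsto_eventually)
  then have "(\<integral>\<omega>. h (corner n (R \<omega>)) \<partial>M) = 0"
    using limit_integral[OF cont_h h01] LIMSEQ_unique by blast
  moreover have "integrable M (\<lambda>\<omega>. h (corner n (R \<omega>)))"
    using h01 by (intro integrable_const_bound[where B = 1]) auto
  ultimately have "AE \<omega> in M. h (corner n (R \<omega>)) = 0"
    using h01 by (subst (asm) integral_nonneg_eq_0_iff_AE) auto
  then show ?thesis by eventually_elim (auto simp: h_def min_def max_def split: if_splits)
qed

text \<open>Relabelling preserves continuous test functions and leaves their annealed expectations
  unchanged, so the limits agree.\<close>

lemma corner_relabel_distr:
  assumes "\<pi> permutes {..<n}"
  shows "distr M borel (\<lambda>\<omega>. corner n (R \<omega>))
    = distr M borel (\<lambda>\<omega>. corner n (\<lambda>s l l'. R \<omega> s (\<pi> l) (\<pi> l')))"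
proof (rule finite_borel_measure_eqI)
  have cont_relabel: "continuous_on UNIV (relabel n \<pi> :: ('s \<times> nat \<times> nat \<Rightarrow> real) \<Rightarrow> _)"
  proof (rule continuous_on_coordinatewise_then_product)
    fix i :: "'s \<times> nat \<times> nat"
    show "continuous_on UNIV (\<lambda>x :: 's \<times> nat \<times> nat \<Rightarrow> real. relabel n \<pi> x i)"
      by (cases i; cases "i \<in> arr_idx n") (auto simp: relabel_def)
  qed
  have [measurable]: "relabel n \<pi> \<in> measurable (borel :: ('s \<times> nat \<times> nat \<Rightarrow> real) measure) borel"
    by (rule borel_measurable_continuous_onI[OF cont_relabel])
  have rel: "(\<lambda>\<omega>. corner n (\<lambda>s l l'. R \<omega> s (\<pi> l) (\<pi> l'))) = (\<lambda>\<omega>. relabel n \<pi> (corner n (R \<omega>)))"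
    by (simp add: relabel_corner[OF assms])
  show "finite_measure (distr M borel (\<lambda>\<omega>. corner n (R \<omega>)))"
    by (intro finite_measure_distr) measurable
  show "finite_measure (distr M borel (\<lambda>\<omega>. corner n (\<lambda>s l l'. R \<omega> s (\<pi> l) (\<pi> l'))))"
    unfolding rel by (intro finite_measure_distr) measurable
  fix h :: "('s \<times> nat \<times> nat \<Rightarrow> real) \<Rightarrow> real"
  assume h: "continuous_on UNIV h" "\<And>x. 0 \<le> h x \<and> h x \<le> 1"
  have [measurable]: "h \<in> borel_measurable borel"
    by (rule borel_measurable_continuous_onI[OF h(1)])
  have "continuous_on UNIV (\<lambda>x. h (relabel n \<pi> x))"
    using continuous_on_compose[OF cont_relabel continuous_on_subset[OF h(1)]] by (simp add: comp_def)
  then have "(\<lambda>k. annealed (P k) (G k) (N k) (I k) n (\<lambda>x. h (relabel n \<pi> x)))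
      \<longlonglongrightarrow> (\<integral>\<omega>. h (relabel n \<pi> (corner n (R \<omega>))) \<partial>M)"
    using h(2) by (rule limit_integral)
  then have "(\<integral>\<omega>. h (corner n (R \<omega>)) \<partial>M) = (\<integral>\<omega>. h (relabel n \<pi> (corner n (R \<omega>))) \<partial>M)"
    unfolding annealed_relabel[OF assms] using limit_integral[OF h, of n] LIMSEQ_unique by blast
  then show "(\<integral>x. h x \<partial>distr M borel (\<lambda>\<omega>. corner n (R \<omega>)))
      = (\<integral>x. h x \<partial>distr M borel (\<lambda>\<omega>. corner n (\<lambda>s l l'. R \<omega> s (\<pi> l) (\<pi> l'))))"
    unfolding rel by (simp add: integral_distr)
qed simp_all

text \<open>Cylinder sets determine the law of the full array, and each of them depends on a finite
  corner, where exchangeability is already known.\<close>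

lemma relabel_prob:
  assumes \<pi>: "\<pi> permutes {..<n}" and X: "X \<in> sets arrays"
  shows "\<P>(\<omega> in M. (\<lambda>(s, l, l'). R \<omega> s (\<pi> l) (\<pi> l')) \<in> X) = \<P>(\<omega> in M. (\<lambda>(s, l, l'). R \<omega> s l l') \<in> X)"
proof -
  define F where "F \<rho> \<omega> = (\<lambda>(s, l, l'). R \<omega> s (\<rho> l) (\<rho> l'))" for \<rho> :: "nat \<Rightarrow> nat" and \<omega>
  have [measurable]: "F \<rho> \<in> measurable M arrays" for \<rho>
    by (rule measurable_PiM_single') (auto simp: F_def space_PiM split_beta)
  have "distr M arrays (F \<pi>) = distr M arrays (F id)"
  proof (rule measure_eqI_PiM_infinite)
    fix J :: "('s \<times> nat \<times> nat) set" and A :: "'s \<times> nat \<times> nat \<Rightarrow> real set"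
    assume J: "finite J" and A: "\<And>i. i \<in> J \<Longrightarrow> A i \<in> sets borel"
    \<comment> \<open>This size is at least \<open>n\<close>, so \<pi> still permutes the replicas
      below it, and it exceeds all replica indices in \<open>J\<close>.\<close>
    define m where "m = n + (\<Sum>(s, l, l')\<in>J. Suc (l + l'))"
    have "Suc (l + l') \<le> m" if "(s, l, l') \<in> J" for s l l'
      using member_le_sum[OF that, of "\<lambda>(s, l, l'). Suc (l + l')"] J by (simp add: m_def)
    then have Jm: "J \<subseteq> arr_idx m"
      by (fastforce simp: arr_idx_def)
    have \<pi>m: "\<pi> permutes {..<m}"
      using \<pi> by (rule permutes_subset) (auto simp: m_def)
    define B where "B = {x. \<forall>i\<in>J. x i \<in> A i}"
    have emb: "prod_emb UNIV (\<lambda>_. borel) J (PiE J A) = B"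
      by (force simp: prod_emb_def B_def space_PiM PiE_iff)
    have B_arrays: "B \<in> sets arrays"
      unfolding emb[symmetric] using J A by (intro sets_PiM_I) auto
    have B_borel: "B \<in> sets borel"
      using B_arrays by (simp add: sets_PiM_equal_borel)
    have corner_B: "corner m (\<lambda>s l l'. R \<omega> s (\<rho> l) (\<rho> l')) \<in> B \<longleftrightarrow> F \<rho> \<omega> \<in> B" for \<omega> \<rho>
      using Jm unfolding B_def F_def corner_def by (force simp: arr_idx_def)
    have meas: "(\<lambda>\<omega>. corner m (\<lambda>s l l'. R \<omega> s (\<pi> l) (\<pi> l'))) \<in> borel_measurable M"
    proof (rule measurable_coordinatewise_then_product)
      fix i :: "'s \<times> nat \<times> nat"
      show "(\<lambda>\<omega>. corner m (\<lambda>s l l'. R \<omega> s (\<pi> l) (\<pi> l')) i) \<in> borel_measurable M"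
        by (cases i; cases "i \<in> arr_idx m") (auto simp: corner_def)
    qed
    have "emeasure (distr M borel (\<lambda>\<omega>. corner m (R \<omega>))) B
        = emeasure (distr M borel (\<lambda>\<omega>. corner m (\<lambda>s l l'. R \<omega> s (\<pi> l) (\<pi> l')))) B"
      by (simp only: corner_relabel_distr[OF \<pi>m])
    then have "emeasure M ((\<lambda>\<omega>. corner m (R \<omega>)) -` B \<inter> space M)
        = emeasure M ((\<lambda>\<omega>. corner m (\<lambda>s l l'. R \<omega> s (\<pi> l) (\<pi> l'))) -` B \<inter> space M)"
      using B_borel meas by (simp add: emeasure_distr)
    moreover have "(\<lambda>\<omega>. corner m (R \<omega>)) -` B = F id -` B"
      using corner_B[of _ id] by auto
    moreover have "(\<lambda>\<omega>. corner m (\<lambda>s l l'. R \<omega> s (\<pi> l) (\<pi> l'))) -` B = F \<pi> -` B"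
      using corner_B by auto
    ultimately show "emeasure (distr M arrays (F \<pi>)) (prod_emb UNIV (\<lambda>_. borel) J (PiE J A))
        = emeasure (distr M arrays (F id)) (prod_emb UNIV (\<lambda>_. borel) J (PiE J A))"
      unfolding emb using B_arrays by (simp add: emeasure_distr)
  next
    show "finite_measure (distr M arrays (F \<pi>))"
      by (intro finite_measure_distr) measurable
  qed simp_all
  then have "measure (distr M arrays (F \<pi>)) X = measure (distr M arrays (F id)) X"
    by simp
  then have "prob (F \<pi> -` X \<inter> space M) = prob (F id -` X \<inter> space M)"
    using X by (simp add: measure_distr)
  moreover have "F \<rho> -` X \<inter> space M = {\<omega> \<in> space M. (\<lambda>(s, l, l'). R \<omega> s (\<rho> l) (\<rho> l')) \<in> X}" for \<rho>
    by (auto simp: F_def)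
  ultimately show ?thesis by simp
qed

section \<open>Convex combinations of the species arrays\<close>

definition weighted :: "('s \<Rightarrow> real) \<Rightarrow> 'm \<Rightarrow> nat \<times> nat \<Rightarrow> real" where
  "weighted w \<omega> = (\<lambda>(l, l'). \<Sum>s\<in>UNIV. w s * R \<omega> s l l')"

text \<open>Each species has a Gram matrix of overlaps: its quadratic form is the site average of
  squared linear combinations of spins.\<close>

lemma weighted_quadratic_form_nonneg:
  fixes J :: "'s \<Rightarrow> nat set" and n :: nat
  assumes "\<And>s. 0 \<le> w s"
  shows "0 \<le> (\<Sum>i<n. \<Sum>j<n. c i * c j * (\<Sum>s\<in>UNIV. w s * overlap (J s) (\<sigma> i) (\<sigma> j)))"
proof -
  have "(\<Sum>i<n. \<Sum>j<n. c i * c j * overlap V (\<sigma> i) (\<sigma> j))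
      = (\<Sum>v\<in>V. (\<Sum>i<n. c i * spin (\<sigma> i) v)\<^sup>2) / real (card V)" for V
  proof -
    have "(\<Sum>v\<in>V. (\<Sum>i<n. c i * spin (\<sigma> i) v)\<^sup>2)
        = (\<Sum>v\<in>V. \<Sum>i<n. \<Sum>j<n. c i * c j * (spin (\<sigma> i) v * spin (\<sigma> j) v))"
      by (simp add: power2_eq_square sum_product mult_ac)
    also have "\<dots> = (\<Sum>i<n. \<Sum>j<n. \<Sum>v\<in>V. c i * c j * (spin (\<sigma> i) v * spin (\<sigma> j) v))"
      by (simp only: sum.swap[of _ V])
    finally show ?thesis
      by (simp add: overlap_def sum_divide_distrib sum_distrib_left)
  qed
  then have nonneg: "0 \<le> (\<Sum>i<n. \<Sum>j<n. c i * c j * overlap V (\<sigma> i) (\<sigma> j))" for V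
    by (simp add: sum_nonneg)
  have "(\<Sum>i<n. \<Sum>j<n. c i * c j * (\<Sum>s\<in>UNIV. w s * overlap (J s) (\<sigma> i) (\<sigma> j)))
      = (\<Sum>i<n. \<Sum>j<n. \<Sum>s\<in>UNIV. w s * (c i * c j * overlap (J s) (\<sigma> i) (\<sigma> j)))"
    by (simp add: sum_distrib_left mult_ac)
  also have "\<dots> = (\<Sum>i<n. \<Sum>s\<in>UNIV. \<Sum>j<n. w s * (c i * c j * overlap (J s) (\<sigma> i) (\<sigma> j)))"
    by (intro sum.cong refl, rule sum.swap)
  also have "\<dots> = (\<Sum>s\<in>UNIV. w s * (\<Sum>i<n. \<Sum>j<n. c i * c j * overlap (J s) (\<sigma> i) (\<sigma> j)))"
    by (subst sum.swap) (simp add: sum_distrib_left)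
  also have "\<dots> \<ge> 0"
    by (rule sum_nonneg) (rule mult_nonneg_nonneg[OF assms nonneg])
  finally show ?thesis .
qed

lemma R_diagonal: "AE \<omega> in M. R \<omega> s i i = 1"
proof -
  have idx: "(s, i, i) \<in> arr_idx (Suc i)" by (simp add: arr_idx_def)
  have one: "overlap V A A = 1" if "finite V" "V \<noteq> {}" for V A
    using that by (simp add: overlap_def spin_def if_distrib cong: if_cong)
  have "AE \<omega> in M. 0 \<le> corner (Suc i) (R \<omega>) (s, i, i) - 1"
    by (rule AE_corner_nonneg) (auto intro!: continuous_intros simp: idx one)
  moreover have "AE \<omega> in M. 0 \<le> 1 - corner (Suc i) (R \<omega>) (s, i, i)"
    by (rule AE_corner_nonneg) (auto intro!: continuous_intros simp: idx one)
  ultimately show ?thesis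
    by eventually_elim (simp add: corner_def idx)
qed

lemma R_symmetric: "AE \<omega> in M. R \<omega> s i j = R \<omega> s j i"
proof -
  define n where "n = Suc (i + j)"
  have idx: "(s, i, j) \<in> arr_idx n" "(s, j, i) \<in> arr_idx n" by (simp_all add: arr_idx_def n_def)
  have comm: "overlap V A B = overlap V B A" for V A B
    by (simp add: overlap_def mult.commute)
  have "AE \<omega> in M. 0 \<le> corner n (R \<omega>) (s, i, j) - corner n (R \<omega>) (s, j, i)"
    by (rule AE_corner_nonneg) (auto intro!: continuous_intros simp: idx comm)
  moreover have "AE \<omega> in M. 0 \<le> corner n (R \<omega>) (s, j, i) - corner n (R \<omega>) (s, i, j)"
    by (rule AE_corner_nonneg) (auto intro!: continuous_intros simp: idx comm)
  ultimately show ?thesis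
    by eventually_elim (simp add: corner_def idx)
qed

lemma weighted_psd:
  assumes "\<And>s. 0 \<le> w s"
  shows "AE \<omega> in M. 0 \<le> (\<Sum>i<n. \<Sum>j<n. c i * c j * weighted w \<omega> (i, j))"
proof -
  define p where "p x = (\<Sum>i<n. \<Sum>j<n. c i * c j * (\<Sum>s\<in>UNIV. w s * x (s, i, j)))"
    for x :: "'s \<times> nat \<times> nat \<Rightarrow> real"
  have "continuous_on UNIV p"
    unfolding p_def by (intro continuous_intros) auto
  moreover have p_restrict: "p (\<lambda>(s, l, l') \<in> arr_idx n. y s l l')
      = (\<Sum>i<n. \<Sum>j<n. c i * c j * (\<Sum>s\<in>UNIV. w s * y s i j))" for y
    unfolding p_def by (intro sum.cong refl arg_cong2[where f = "(*)"]) (simp_all add: arr_idx_def)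
  ultimately have "AE \<omega> in M. 0 \<le> p (corner n (R \<omega>))"
    by (intro AE_corner_nonneg) (simp_all only: p_restrict weighted_quadratic_form_nonneg[OF assms])
  then show ?thesis
    unfolding corner_def p_restrict by (simp add: weighted_def)
qed

lemma relabel_prob_weighted:
  assumes \<pi>: "\<pi> permutes {..<n}" and [measurable]: "X \<in> sets arrays"
  shows "\<P>(\<omega> in M. (\<lambda>(i, j). weighted w \<omega> (\<pi> i, \<pi> j)) \<in> X) = \<P>(\<omega> in M. weighted w \<omega> \<in> X)"
proof -
  define T where "T x = (\<lambda>(i, j). \<Sum>s\<in>UNIV. w s * x (s, i, j))" for x :: "'s \<times> nat \<times> nat \<Rightarrow> real"
  have [measurable]: "T \<in> measurable arrays arrays"
    by (rule measurable_PiM_single') (auto simp: T_def space_PiM split_beta)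
  have "{x \<in> space arrays. T x \<in> X} \<in> sets arrays" by measurable
  then have "{x. T x \<in> X} \<in> sets arrays" by (simp add: space_PiM)
  from relabel_prob[OF \<pi> this] show ?thesis
    by (simp add: T_def weighted_def)
qed

text \<open>The multi-species identities admit any bounded measurable function of the whole overlap
  vector, in particular the indicator that its weighted sum lies in \<open>A\<close>. This is what
  couples the species.\<close>

lemma weighted_ghirlanda_guerra:
  assumes GG: "multi_species_GG M R"
    and n: "2 \<le> n" and [measurable]: "S \<in> sets arrays" "A \<in> sets borel"
    and S: "\<And>x y. (\<And>i j. i < n \<Longrightarrow> j < n \<Longrightarrow> x (i, j) = y (i, j)) \<Longrightarrow> x \<in> S \<longleftrightarrow> y \<in> S"
  shows "real n * \<P>(\<omega> in M. weighted w \<omega> \<in> S \<and> weighted w \<omega> (0, n) \<in> A) =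
    \<P>(\<omega> in M. weighted w \<omega> \<in> S) * \<P>(\<omega> in M. weighted w \<omega> (0, 1) \<in> A)
    + (\<Sum>l\<in>{1..<n}. \<P>(\<omega> in M. weighted w \<omega> \<in> S \<and> weighted w \<omega> (0, l) \<in> A))"
proof -
  \<comment> \<open>\<open>T\<close> computes the weighted array from the corner and pads it with 0;
    the locality of \<open>S\<close> makes the padding invisible.\<close>
  define T where "T x = (\<lambda>(i, j). if i < n \<and> j < n then \<Sum>s\<in>UNIV. w s * x (s, i, j) else 0)"
    for x :: "'s \<times> nat \<times> nat \<Rightarrow> real"
  define f where "f x = (indicator S (T x) :: real)" for x
  define \<phi> where "\<phi> v = (indicator A (\<Sum>s\<in>UNIV. w s * v s) :: real)" for v :: "'s \<Rightarrow> real"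
  have T [measurable]: "T \<in> measurable (arr_M n) arrays"
  proof (rule measurable_PiM_single')
    fix i :: "nat \<times> nat"
    show "(\<lambda>x. T x i) \<in> borel_measurable (arr_M n)"
    proof (cases "fst i < n \<and> snd i < n")
      case True
      then have [measurable]: "(\<lambda>x. x (s, i)) \<in> borel_measurable (arr_M n)" for s
        unfolding arr_M_def by (intro measurable_component_singleton) (cases i; simp add: arr_idx_def)
      have "(\<lambda>x. \<Sum>s\<in>UNIV. w s * x (s, i)) \<in> borel_measurable (arr_M n)" by measurable
      then show ?thesis using True by (simp add: T_def split_beta)
    next
      case False
      then have "(\<lambda>x. T x i) = (\<lambda>_. 0)" by (auto simp: T_def split_beta)
      then show ?thesis by simp
    qed
  qed (auto simp: space_PiM)
  have f: "f \<in> borel_measurable (arr_M n)" unfolding f_def by measurable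
  have \<phi>: "\<phi> \<in> borel_measurable (PiM UNIV (\<lambda>_. borel))" unfolding \<phi>_def by measurable
  have bounded: "\<exists>B. \<forall>x. \<bar>\<phi> x\<bar> \<le> B" "\<exists>B. \<forall>x. \<bar>f x\<bar> \<le> B"
    unfolding \<phi>_def f_def by (auto intro!: exI[of _ 1] simp: indicator_def)
  have W [measurable]: "(\<lambda>\<omega>. weighted w \<omega> i) \<in> borel_measurable M" for i
    by (simp add: weighted_def split_beta)
  have [measurable]: "weighted w \<in> measurable M arrays"
    by (rule measurable_PiM_single') (auto simp: space_PiM)
  have "T (corner n (R \<omega>)) \<in> S \<longleftrightarrow> weighted w \<omega> \<in> S" for \<omega>
    by (rule S) (simp add: T_def weighted_def corner_def arr_idx_def)
  then have F: "f (corner n (R \<omega>)) = indicator {\<omega>. weighted w \<omega> \<in> S} \<omega>" for \<omega>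
    by (simp add: f_def indicator_def)
  have \<Phi>: "\<phi> (\<lambda>s. R \<omega> s i j) = indicator {\<omega>. weighted w \<omega> (i, j) \<in> A} \<omega>" for \<omega> i j
    by (simp add: \<phi>_def indicator_def weighted_def)
  have "(\<integral>\<omega>. f (corner n (R \<omega>)) * \<phi> (\<lambda>s. R \<omega> s 0 n) \<partial>M) =
      (1 / real n) * (\<integral>\<omega>. f (corner n (R \<omega>)) \<partial>M) * (\<integral>\<omega>. \<phi> (\<lambda>s. R \<omega> s 0 1) \<partial>M)
      + (1 / real n) * (\<Sum>l\<in>{1..<n}. \<integral>\<omega>. f (corner n (R \<omega>)) * \<phi> (\<lambda>s. R \<omega> s 0 l) \<partial>M)"
    using GG[unfolded multi_species_GG_def Let_def] f \<phi> bounded n by blast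
  then show ?thesis
    unfolding F \<Phi> expectation_indicator_Collect using n by (simp add: field_simps)
qed

lemma gg_array_weighted:
  assumes GG: "multi_species_GG M R" and w: "\<And>s. 0 \<le> w s" "(\<Sum>s\<in>UNIV. w s) = 1"
  shows "gg_array M (weighted w)"
proof (unfold_locales, goal_cases)
  case (1 i)
  then show ?case by (simp add: weighted_def split_beta)
next
  case (2 i j)
  have "AE \<omega> in M. \<forall>s\<in>UNIV. R \<omega> s i j = R \<omega> s j i"
    by (intro AE_finite_allI R_symmetric) simp
  then show ?case by eventually_elim (simp add: weighted_def)
next
  case (3 i)
  have "AE \<omega> in M. \<forall>s\<in>UNIV. R \<omega> s i i = 1"
    by (intro AE_finite_allI R_diagonal) simp
  then show ?case by eventually_elim (simp add: weighted_def w)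
next
  case (4 c n)
  then show ?case by (rule weighted_psd[OF w(1)])
next
  case (5 \<pi> n X)
  then show ?case by (rule relabel_prob_weighted)
next
  case (6 n S A)
  show ?case using 6(1,2,4) by (rule weighted_ghirlanda_guerra[OF GG]) (rule 6(3))
qed

lemma weighted_single: "weighted (\<lambda>u. of_bool (u = s)) \<omega> (i, j) = R \<omega> s i j"
  by (simp add: weighted_def of_bool_def if_distrib[of "\<lambda>x. x * _"] cong: if_cong)

lemma weighted_pair:
  "weighted (\<lambda>u. (of_bool (u = s) + of_bool (u = t)) / 2) \<omega> (i, j) = (R \<omega> s i j + R \<omega> t i j) / 2"
proof -
  have "weighted (\<lambda>u. (of_bool (u = s) + of_bool (u = t)) / 2) \<omega> (i, j)
      = (weighted (\<lambda>u. of_bool (u = s)) \<omega> (i, j) + weighted (\<lambda>u. of_bool (u = t)) \<omega> (i, j)) / 2"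
    unfolding weighted_def prod.case sum.distrib[symmetric] sum_divide_distrib
    by (intro sum.cong refl) (simp add: algebra_simps add_divide_distrib)
  then show ?thesis by (simp only: weighted_single)
qed

section \<open>Comparability of overlap vectors\<close>

lemma R_range:
  assumes "multi_species_GG M R" "i \<noteq> j"
  shows "AE \<omega> in M. R \<omega> s i j \<in> {0..1}"
proof -
  interpret Q: gg_array M "weighted (\<lambda>u. of_bool (u = s))"
    using assms(1) by (rule gg_array_weighted) simp_all
  show ?thesis
    using Q.Q_bounds[OF assms(2)] Q.Q_nonneg[OF assms(2)]
    by eventually_elim (simp add: weighted_single)
qed

text \<open>If two species ordered the overlaps of replica 0 with replicas 1 and 2 differently, ultrametricity
  within each species would determine their overlaps of replicas 1 and 2, and the average of the two
  arrays would not be ultrametric.\<close>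
lemma overlaps_comparable:
  assumes GG: "multi_species_GG M R"
  shows "AE \<omega> in M. \<not> (R \<omega> s 0 1 < R \<omega> s 0 2 \<and> R \<omega> t 0 2 < R \<omega> t 0 1)"
proof -
  interpret S: gg_array M "weighted (\<lambda>u. of_bool (u = s))"
    using GG by (rule gg_array_weighted) simp_all
  interpret T: gg_array M "weighted (\<lambda>u. of_bool (u = t))"
    using GG by (rule gg_array_weighted) simp_all
  interpret A: gg_array M "weighted (\<lambda>u. (of_bool (u = s) + of_bool (u = t)) / 2)"
    using GG by (rule gg_array_weighted) (simp_all add: sum.distrib flip: sum_divide_distrib)
  show ?thesis
    \<comment> \<open>In the excluded case the overlap of replicas 1 and 2 equals that of 0 and 1 in
      species \<open>s\<close>, and that of 0 and 2 in species \<open>t\<close>. Its average is then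
      strictly below both averaged overlaps of replica 0.\<close>
    using S.ultrametric T.ultrametric A.ultrametric(3)
    unfolding weighted_single weighted_pair
    by eventually_elim (auto simp: min_def split: if_splits)
qed

text \<open>The identity for two replicas, with the nonnegative term for replica 1 dropped.\<close>

lemma two_replica_prob:
  assumes GG: "multi_species_GG M R" and "open U" "open V"
  shows "\<P>(\<omega> in M. (\<lambda>s. R \<omega> s 0 1) \<in> U) * \<P>(\<omega> in M. (\<lambda>s. R \<omega> s 0 1) \<in> V)
    \<le> 2 * \<P>(\<omega> in M. (\<lambda>s. R \<omega> s 0 1) \<in> U \<and> (\<lambda>s. R \<omega> s 0 2) \<in> V)"
proof -
  define f where "f x = (indicator U (\<lambda>s. x (s, 0, 1)) :: real)" for x :: "'s \<times> nat \<times> nat \<Rightarrow> real"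
  have [measurable]: "U \<in> sets arrays" "V \<in> sets arrays"
    using assms(2,3) by (simp_all add: sets_PiM_equal_borel)
  have [measurable]: "(\<lambda>x s. x (s, 0, 1)) \<in> measurable (arr_M 2) arrays"
  proof (rule measurable_PiM_single')
    show "(\<lambda>x. x (s, 0, 1)) \<in> borel_measurable (arr_M 2)" for s
      unfolding arr_M_def by (intro measurable_component_singleton) (simp add: arr_idx_def)
  qed (auto simp: space_PiM)
  have f: "f \<in> borel_measurable (arr_M 2)" unfolding f_def by measurable
  have \<phi>: "(indicator V :: _ \<Rightarrow> real) \<in> borel_measurable arrays" by measurable
  have bounded: "\<exists>B. \<forall>x. \<bar>indicator V x :: real\<bar> \<le> B" "\<exists>B. \<forall>x. \<bar>f x\<bar> \<le> B"
    unfolding f_def by (auto intro!: exI[of _ 1] simp: indicator_def)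
  have F: "f (corner 2 (R \<omega>)) = indicator {\<omega>. (\<lambda>s. R \<omega> s 0 1) \<in> U} \<omega>" for \<omega>
    by (simp add: f_def corner_def arr_idx_def indicator_def)
  have \<Phi>: "indicator V (\<lambda>s. R \<omega> s i j) = indicator {\<omega>. (\<lambda>s. R \<omega> s i j) \<in> V} \<omega>" for \<omega> i j
    by (simp add: indicator_def)
  have "(\<integral>\<omega>. f (corner 2 (R \<omega>)) * indicator V (\<lambda>s. R \<omega> s 0 2) \<partial>M) =
      (1 / real 2) * (\<integral>\<omega>. f (corner 2 (R \<omega>)) \<partial>M) * (\<integral>\<omega>. indicator V (\<lambda>s. R \<omega> s 0 1) \<partial>M)
      + (1 / real 2) * (\<Sum>l\<in>{1..<2}. \<integral>\<omega>. f (corner 2 (R \<omega>)) * indicator V (\<lambda>s. R \<omega> s 0 l) \<partial>M)"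
    using GG[unfolded multi_species_GG_def Let_def] f \<phi> bounded by blast
  then show ?thesis
    unfolding F \<Phi> expectation_indicator_Collect by (simp add: sum_nonneg)
qed

section \<open>The support of the overlap vector\<close>

definition support :: "('s \<Rightarrow> real) set" where
  "support = {x. \<forall>U. open U \<longrightarrow> x \<in> U \<longrightarrow> 0 < \<P>(\<omega> in M. (\<lambda>s. R \<omega> s 0 1) \<in> U)}"

lemma overlap_vector_measurable [measurable]: "(\<lambda>\<omega> s. R \<omega> s i j) \<in> borel_measurable M"
  by (rule measurable_coordinatewise_then_product) measurable

text \<open>By exchangeability the overlap vectors of all pairs of distinct replicas have the same
  law, hence the same support.\<close>

lemma AE_support:
  assumes "i \<noteq> j"
  shows "AE \<omega> in M. (\<lambda>s. R \<omega> s i j) \<in> support"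
proof -
  obtain \<pi> n where \<pi>: "\<pi> permutes {..<n}" "\<pi> 0 = i" "\<pi> 1 = j"
    using ex_permutation_pair[OF assms] by blast
  have eq: "\<P>(\<omega> in M. (\<lambda>s. R \<omega> s i j) \<in> U) = \<P>(\<omega> in M. (\<lambda>s. R \<omega> s 0 1) \<in> U)"
    if "open U" for U
  proof -
    have [measurable]: "U \<in> sets arrays" using that by (simp add: sets_PiM_equal_borel)
    have [measurable]: "(\<lambda>x s. x (s, 0, 1)) \<in> measurable (arrays :: ('s \<times> nat \<times> nat \<Rightarrow> real) measure) arrays"
      by (rule measurable_PiM_single') (auto simp: space_PiM)
    have "{x \<in> space arrays. (\<lambda>s :: 's. x (s, 0 :: nat, 1 :: nat)) \<in> U} \<in> sets arrays" by measurable
    then have "{x. (\<lambda>s :: 's. x (s, 0 :: nat, 1 :: nat)) \<in> U} \<in> sets arrays" by (simp add: space_PiM)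
    from relabel_prob[OF \<pi>(1) this] show ?thesis using \<pi> by simp
  qed
  have "AE \<omega> in M. (\<lambda>s. R \<omega> s i j) \<in>
      {x. \<forall>U. open U \<longrightarrow> x \<in> U \<longrightarrow> 0 < \<P>(\<omega> in M. (\<lambda>s. R \<omega> s i j) \<in> U)}"
    by (rule AE_in_support) measurable
  then show ?thesis
    by eventually_elim (simp add: support_def eq[symmetric] del: One_nat_def)
qed

text \<open>Opposite strict orderings persist on open neighbourhoods cut at the coordinate
  midpoints. Both have positive probability, so by \<open>two_replica_prob\<close> the pairs 0, 1
  and 0, 2 would fall into them together with positive probability, against comparability.\<close>

lemma support_chain:
  assumes GG: "multi_species_GG M R" and "x \<in> support" "y \<in> support"
  shows "\<not> (x s < y s \<and> y t < x t)"
proof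
  assume *: "x s < y s \<and> y t < x t"
  define a where "a = (x s + y s) / 2"
  define b where "b = (x t + y t) / 2"
  define U where "U = {z :: 's \<Rightarrow> real. z s < a} \<inter> {z. b < z t}"
  define V where "V = {z :: 's \<Rightarrow> real. a < z s} \<inter> {z. z t < b}"
  have "open U" "open V"
    unfolding U_def V_def by (intro open_Int open_Collect_less continuous_intros continuous_on_product_coordinates)+
  moreover have "x \<in> U" "y \<in> V"
    using * by (auto simp: U_def V_def a_def b_def)
  ultimately have "0 < \<P>(\<omega> in M. (\<lambda>s. R \<omega> s 0 1) \<in> U) * \<P>(\<omega> in M. (\<lambda>s. R \<omega> s 0 1) \<in> V)"
    using assms(2,3) by (auto simp: support_def)
  also have "\<dots> \<le> 2 * \<P>(\<omega> in M. (\<lambda>s. R \<omega> s 0 1) \<in> U \<and> (\<lambda>s. R \<omega> s 0 2) \<in> V)"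
    by (rule two_replica_prob[OF GG]) fact+
  also have "\<P>(\<omega> in M. (\<lambda>s. R \<omega> s 0 1) \<in> U \<and> (\<lambda>s. R \<omega> s 0 2) \<in> V) = 0"
  proof -
    have [measurable]: "U \<in> sets borel" "V \<in> sets borel" using \<open>open U\<close> \<open>open V\<close> by auto
    have "AE \<omega> in M. \<not> ((\<lambda>s. R \<omega> s 0 1) \<in> U \<and> (\<lambda>s. R \<omega> s 0 2) \<in> V)"
      using overlaps_comparable[OF GG, of s t] by eventually_elim (auto simp: U_def V_def)
    then show ?thesis by (subst prob_Collect_eq_0) auto
  qed
  finally show False by simp
qed

end

section \<open>Synchronization of the species overlaps\<close>

theorem theorem4:
  fixes lam :: "'s::finite \<Rightarrow> real"
    and M :: "'m measure"
    and R :: "'m \<Rightarrow> 's \<Rightarrow> nat \<Rightarrow> nat \<Rightarrow> real"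
    and N :: "nat \<Rightarrow> nat" and I :: "nat \<Rightarrow> 's \<Rightarrow> nat set"
    and P :: "nat \<Rightarrow> 'w measure" and G :: "nat \<Rightarrow> 'w \<Rightarrow> nat set \<Rightarrow> real"
  assumes lam: "\<forall>s. 0 < lam s \<and> lam s < 1" "(\<Sum>s\<in>UNIV. lam s) = 1"
    and M: "prob_space M"
    and R_meas: "\<forall>s l l'. (\<lambda>\<omega>. R \<omega> s l l') \<in> borel_measurable M"
    and lim: "overlap_limit lam M R N I P G"
    and GG: "multi_species_GG M R"
  shows "\<exists>L :: 's \<Rightarrow> real \<Rightarrow> real. \<forall>s.
           mono_on {0..1} (L s) \<and> L s ` {0..1} \<subseteq> {0..1} \<and>
           (1 / lam s)-lipschitz_on {0..1} (L s) \<and>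
           (\<forall>l l'. AE \<omega> in M. R \<omega> s l l' = L s (\<Sum>t\<in>UNIV. lam t * R \<omega> t l l'))"
proof -
  interpret prob_space M by fact
  interpret overlap_limit_array M lam R N I P G
    using lam R_meas lim by unfold_locales auto
  \<comment> \<open>The constant vector 1 consists of the self-overlaps, so the case
    \<open>l = l'\<close> is covered. It makes \<open>D\<close> nonempty and dominates the unit
    cube, so the chain property survives.\<close>
  define D where "D = insert (\<lambda>_. 1) (support \<inter> {x. \<forall>s. x s \<in> {0..1}})"
  define g where "g x = (\<Sum>t\<in>UNIV. lam t * x t)" for x :: "'s \<Rightarrow> real"
  have D_range: "x s \<in> {0..1}" if "x \<in> D" for x s
    using that by (auto simp: D_def)
  have chain: "\<not> (x s < y s \<and> y t < x t)" if "x \<in> D" "y \<in> D" for x y s t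
    using that D_range[OF that(1), of t] D_range[OF that(2), of s] support_chain[OF GG, of x y s t]
    by (auto simp: D_def)
  have "\<exists>L. mono_on {0..1} L \<and> L ` {0..1} \<subseteq> {0..1} \<and> (1 / lam s)-lipschitz_on {0..1} L \<and>
      (\<forall>x\<in>D. L (g x) = x s)" for s
  proof (rule monotone_lipschitz_extension)
    show "D \<noteq> {}" by (simp add: D_def)
    have pos: "0 < lam s" using lam by simp
    then show "0 \<le> 1 / lam s" by simp
    fix x y assume xy: "x \<in> D" "y \<in> D"
    show "y s - x s \<le> 1 / lam s * max 0 (g y - g x)"
    proof (cases "x s < y s")
      case True
      \<comment> \<open>On a chain a strict increase in one coordinate forces all others to increase
        weakly. The increment of \<open>g\<close> is then a sum of nonnegative terms and at least
        its term for \<open>s\<close>, whence the constant \<open>1 / lam s\<close>.\<close>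
      then have le: "x t \<le> y t" for t using chain[OF xy, of s t] by force
      have "lam s * (y s - x s) \<le> (\<Sum>t\<in>UNIV. lam t * (y t - x t))"
        using le lam by (intro member_le_sum) (simp_all add: less_imp_le)
      also have "\<dots> = g y - g x"
        by (simp add: g_def right_diff_distrib sum_subtractf)
      also have "\<dots> \<le> max 0 (g y - g x)" by simp
      finally show ?thesis using pos by (simp add: field_simps)
    next
      case False
      then have "y s - x s \<le> 0" by simp
      also have "0 \<le> 1 / lam s * max 0 (g y - g x)" using pos by simp
      finally show ?thesis .
    qed
  qed (use D_range in auto)
  then obtain L where L: "\<And>s. mono_on {0..1} (L s) \<and> L s ` {0..1} \<subseteq> {0..1}
      \<and> (1 / lam s)-lipschitz_on {0..1} (L s) \<and> (\<forall>x\<in>D. L s (g x) = x s)"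
    by metis
  have in_D: "AE \<omega> in M. (\<lambda>s. R \<omega> s l l') \<in> D" for l l'
  proof (cases "l = l'")
    case True
    have "AE \<omega> in M. \<forall>s\<in>UNIV. R \<omega> s l l = 1"
      by (intro AE_finite_allI R_diagonal) simp
    then show ?thesis unfolding True[symmetric] by eventually_elim (simp add: D_def)
  next
    case False
    have "AE \<omega> in M. \<forall>s\<in>UNIV. R \<omega> s l l' \<in> {0..1}"
      by (intro AE_finite_allI R_range[OF GG False]) simp
    with AE_support[OF False] show ?thesis
      by eventually_elim (simp add: D_def)
  qed
  have "AE \<omega> in M. R \<omega> s l l' = L s (\<Sum>t\<in>UNIV. lam t * R \<omega> t l l')" for s l l'
    using in_D[of l l']
  proof eventually_elim
    case (elim \<omega>)
    then have "L s (g (\<lambda>s. R \<omega> s l l')) = R \<omega> s l l'" using L by blast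
    then show ?case by (simp add: g_def)
  qed
  with L show ?thesis by blast
qed

end
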